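(* The mapping $F:\mathcal{Q}\to\mathcal{K}$ given by $$F[st,su,tv,uv]=\big[s^2t,\ s^2u,\ t(v^2+isv),\ u(v^2-isv)\big],\qquad ([s,v],[t,u])\in\mathbb{CP}^1\times\mathbb{CP}^1,$$ is a birational equivalence between the quadric $\mathcal{Q}$ and the quartic surface $\mathcal{K}$. In fact, $F$ maps $\mathcal{Q}$ onto $\mathcal{K}$ and is injective on the complement of $m_{02}\cup m_{13}$, over which it is a $2:1$ branched covering. The singular locus of $\mathcal{K}$ is the union $m_{02}\cup m_{13}\cup m_{01}$, and the set of cusp points is $m_{01}\cup\left\{\left[0,1,0,\frac14\right],\left[1,0,\frac14,0\right]\right\}$.
   Context: $\mathcal{Q}=\{[Z_0,Z_1,Z_2,Z_3]\in\mathbb{CP}^3:Z_0Z_3=Z_1Z_2\}$, identified with $\mathbb{CP}^1\times\mathbb{CP}^1$ via $([s,v],[t,u])\mapsto[st,su,tv,uv]$. $\mathcal{K}\subset\mathbb{CP}^3$ is the surface $K=0$, where $$K(Z_0,Z_1,Z_2,Z_3)=(Z_1Z_2-Z_0Z_3)^2+2Z_0Z_1(Z_1Z_2+Z_0Z_3).$$ For $k\neq l$, $m_{kl}$ is the line $\{[Z_0,Z_1,Z_2,Z_3]\in\mathbb{CP}^3:Z_k=0=Z_l\}$. The lines $m_{02},m_{13}$ lie both in $\mathcal{Q}$ and in $\mathcal{K}$; "over which it is a $2:1$ branched covering" means that $F$ restricts to $2:1$ branched coverings $m_{02}\to m_{02}$ and $m_{13}\to m_{13}$. A singular point of $\mathcal{K}$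 is called a cusp point if all $2\times2$ minors of the Hessian matrix $\left(\frac{\partial^2K}{\partial Z_k\partial Z_l}\right)$ vanish there. *)

theory Defs
  imports "HOL-Analysis.Analysis"
begin

section \<open>Complex projective space\<close>

text \<open>\<open>'n cproj\<close> is the projectivisation of \<open>\<complex>\<^sup>n\<close>, so that \<open>4 cproj\<close> is \<open>\<complex>\<P>\<^sup>3\<close>.
  The value of \<open>abs_cproj\<close> at the zero vector is meaningless.\<close>

definition cproj_rel :: "complex^'n \<Rightarrow> complex^'n \<Rightarrow> bool" where
  "cproj_rel x y \<longleftrightarrow> x \<noteq> 0 \<and> y \<noteq> 0 \<and> (\<exists>c. c \<noteq> 0 \<and> y = c *s x)"

lemma part_equivp_cproj_rel: "part_equivp (cproj_rel :: complex^'n \<Rightarrow> complex^'n \<Rightarrow> bool)"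
proof (rule part_equivpI)
  have "cproj_rel (1 :: complex^'n) 1"
    unfolding cproj_rel_def by (intro conjI exI[of _ 1]) auto
  then show "\<exists>x :: complex^'n. cproj_rel x x" ..
  show "symp (cproj_rel :: complex^'n \<Rightarrow> complex^'n \<Rightarrow> bool)"
  proof (rule sympI)
    fix x y :: "complex^'n" assume "cproj_rel x y"
    then obtain c where "x \<noteq> 0" "y \<noteq> 0" "c \<noteq> 0" "y = c *s x"
      unfolding cproj_rel_def by blast
    then show "cproj_rel y x"
      unfolding cproj_rel_def by (intro conjI exI[of _ "inverse c"]) auto
  qed
  show "transp (cproj_rel :: complex^'n \<Rightarrow> complex^'n \<Rightarrow> bool)"
  proof (rule transpI)
    fix x y z :: "complex^'n" assume "cproj_rel x y" "cproj_rel y z"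
    then obtain c d where "x \<noteq> 0" "z \<noteq> 0" "c \<noteq> 0" "d \<noteq> 0" "y = c *s x" "z = d *s y"
      unfolding cproj_rel_def by blast
    then show "cproj_rel x z"
      unfolding cproj_rel_def by (intro conjI exI[of _ "d * c"]) auto
  qed
qed

quotient_type (overloaded) 'n cproj = "complex^('n::finite)" / partial: cproj_rel
  by (rule part_equivp_cproj_rel)

text \<open>The quotient topology, for the topological notion of branched covering.\<close>

instantiation cproj :: (finite) topological_space
begin

definition open_cproj :: "'a cproj set \<Rightarrow> bool" where
  "open_cproj U \<longleftrightarrow> open {z :: complex^'a. z \<noteq> 0 \<and> abs_cproj z \<in> U}"

instance
proof
  have "{z :: complex^'a. z \<noteq> 0 \<and> abs_cproj z \<in> UNIV} = - {0}" by auto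
  then show "open (UNIV :: 'a cproj set)"
    unfolding open_cproj_def using open_Compl[OF closed_singleton[of "0 :: complex^'a"]] by metis
next
  fix S T :: "'a cproj set" assume "open S" "open T"
  moreover have "{z :: complex^'a. z \<noteq> 0 \<and> abs_cproj z \<in> S \<inter> T} =
      {z. z \<noteq> 0 \<and> abs_cproj z \<in> S} \<inter> {z. z \<noteq> 0 \<and> abs_cproj z \<in> T}" by auto
  ultimately show "open (S \<inter> T)"
    unfolding open_cproj_def by (simp add: open_Int)
next
  fix K :: "'a cproj set set" assume "\<forall>S\<in>K. open S"
  moreover have "{z :: complex^'a. z \<noteq> 0 \<and> abs_cproj z \<in> \<Union>K} =
      (\<Union>S\<in>K. {z. z \<noteq> 0 \<and> abs_cproj z \<in> S})" by auto
  ultimately show "open (\<Union>K)"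
    unfolding open_cproj_def by (simp add: open_UN)
qed

end

section \<open>Rational maps and birational equivalences\<close>

inductive homogeneous_poly :: "nat \<Rightarrow> (complex^'n \<Rightarrow> complex) \<Rightarrow> bool" where
  const: "homogeneous_poly 0 (\<lambda>z. c)"
| coord: "homogeneous_poly 1 (\<lambda>z. z $ i)"
| add: "homogeneous_poly d f \<Longrightarrow> homogeneous_poly d g \<Longrightarrow> homogeneous_poly d (\<lambda>z. f z + g z)"
| mult: "homogeneous_poly d f \<Longrightarrow> homogeneous_poly e g \<Longrightarrow>
    homogeneous_poly (d + e) (\<lambda>z. f z * g z)"

text \<open>The Zariski topology is generated by the complements of the hypersurfaces \<open>f = 0\<close>.\<close>

definition zariski :: "'n::finite cproj topology" where
  "zariski = topology_generated_by
     {{abs_cproj z | z. z \<noteq> 0 \<and> f z \<noteq> 0} | f. \<exists>d. homogeneous_poly d f}"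

definition zariski_open_dense_in :: "'n::finite cproj set \<Rightarrow> 'n cproj set \<Rightarrow> bool" where
  "zariski_open_dense_in X U \<longleftrightarrow>
     openin (subtopology zariski X) U \<and> (subtopology zariski X) closure_of U = X"

definition regular_on :: "'n::finite cproj set \<Rightarrow> ('n cproj \<Rightarrow> 'm::finite cproj) \<Rightarrow> bool" where
  "regular_on U f \<longleftrightarrow>
     (\<forall>p\<in>U. \<exists>W d P. openin (subtopology zariski U) W \<and> p \<in> W \<and>
        (\<forall>i. homogeneous_poly d (\<lambda>z. P z $ i)) \<and>
        (\<forall>z. z \<noteq> 0 \<and> abs_cproj z \<in> W \<longrightarrow> P z \<noteq> 0 \<and> f (abs_cproj z) = abs_cproj (P z)))"

text \<open>A rational map from \<open>X\<close> to \<open>Y\<close> is represented by a regular map on a dense Zariski open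
  subset \<open>U\<close> of \<open>X\<close> (if \<open>X\<close> is irreducible, dense just means nonempty).\<close>

definition rational_map ::
    "'n::finite cproj set \<Rightarrow> 'm::finite cproj set \<Rightarrow> 'n cproj set \<Rightarrow> ('n cproj \<Rightarrow> 'm cproj) \<Rightarrow> bool"
  where
  "rational_map X Y U f \<longleftrightarrow> zariski_open_dense_in X U \<and> regular_on U f \<and> f ` U \<subseteq> Y"

text \<open>\<open>(V, g)\<close> is a left inverse of \<open>(U, f)\<close> as a rational map: the composite is defined and equal
  to the identity on a dense open set.\<close>

definition rational_left_inverse ::
    "'n::finite cproj set \<Rightarrow> 'n cproj set \<Rightarrow> ('n cproj \<Rightarrow> 'm::finite cproj) \<Rightarrow>
     'm cproj set \<Rightarrow> ('m cproj \<Rightarrow> 'n cproj) \<Rightarrow> bool"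
  where
  "rational_left_inverse X U f V g \<longleftrightarrow>
     (\<exists>U'. U' \<subseteq> U \<and> zariski_open_dense_in X U' \<and> f ` U' \<subseteq> V \<and> (\<forall>p\<in>U'. g (f p) = p))"

definition birational_equivalence ::
    "'n::finite cproj set \<Rightarrow> 'm::finite cproj set \<Rightarrow> 'n cproj set \<Rightarrow> ('n cproj \<Rightarrow> 'm cproj) \<Rightarrow> bool"
  where
  "birational_equivalence X Y U f \<longleftrightarrow>
     rational_map X Y U f \<and>
     (\<exists>V g. rational_map Y X V g \<and>
        rational_left_inverse X U f V g \<and> rational_left_inverse Y V g U f)"

section \<open>Branched coverings of surfaces\<close>

text \<open>Every point of \<open>S\<close> and its image have coordinate discs in which \<open>f\<close> is \<open>z \<mapsto> z ^ k\<close>, and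
  \<open>f\<close> is a \<open>d\<close>-sheeted covering away from a finite subset \<open>B\<close> of the target.\<close>

definition branched_covering ::
    "nat \<Rightarrow> ('a::topological_space \<Rightarrow> 'b::topological_space) \<Rightarrow> 'a set \<Rightarrow> 'b set \<Rightarrow> bool"
  where
  "branched_covering d f S T \<longleftrightarrow>
     continuous_on S f \<and> f ` S = T \<and>
     (\<exists>B. finite B \<and> B \<subseteq> T \<and> covering_space (S - f -` B) f (T - B) \<and>
        (\<forall>y \<in> T - B. finite {x \<in> S. f x = y} \<and> card {x \<in> S. f x = y} = d)) \<and>
     (\<forall>x\<in>S. \<exists>U V k \<phi> \<phi>' \<psi> \<psi>'. x \<in> U \<and>
        openin (top_of_set S) U \<and> openin (top_of_set T) V \<and>
        homeomorphism U (ball (0::complex) 1) \<phi> \<phi>' \<and> \<phi> x = 0 \<and>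
        homeomorphism V (ball (0::complex) 1) \<psi> \<psi>' \<and> \<psi> (f x) = 0 \<and>
        f ` U \<subseteq> V \<and> k \<ge> (1::nat) \<and> (\<forall>y\<in>U. \<psi> (f y) = \<phi> y ^ k))"

section \<open>Singular points and cusp points of a projective hypersurface\<close>

definition partial :: "'n::finite \<Rightarrow> (complex^'n \<Rightarrow> complex) \<Rightarrow> complex^'n \<Rightarrow> complex" where
  "partial k f z = deriv (\<lambda>w. f (\<chi> i. if i = k then w else z $ i)) (z $ k)"

definition hessian :: "(complex^'n \<Rightarrow> complex) \<Rightarrow> complex^'n \<Rightarrow> complex^'n^'n::finite" where
  "hessian f z = (\<chi> k l. partial k (partial l f) z)"

definition hypersurface :: "(complex^'n \<Rightarrow> complex) \<Rightarrow> 'n::finite cproj set" where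
  "hypersurface f = {abs_cproj z | z. z \<noteq> 0 \<and> f z = 0}"

text \<open>Singularity is understood with respect to the equation \<open>f\<close> (Jacobian criterion). For a
  polynomial without multiple factors this depends only on the hypersurface \<open>f = 0\<close>.\<close>

definition singular_locus :: "(complex^'n \<Rightarrow> complex) \<Rightarrow> 'n::finite cproj set" where
  "singular_locus f = {abs_cproj z | z. z \<noteq> 0 \<and> f z = 0 \<and> (\<forall>k. partial k f z = 0)}"

text \<open>The condition on the minors does not depend on the homogeneous coordinates \<open>z\<close>
  when \<open>f\<close> is homogeneous.\<close>

definition cusp_points :: "(complex^'n \<Rightarrow> complex) \<Rightarrow> 'n::finite cproj set" where
  "cusp_points f = {abs_cproj z | z. z \<noteq> 0 \<and> abs_cproj z \<in> singular_locus f \<and>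
     (\<forall>i j k l. hessian f z $ i $ k * hessian f z $ j $ l
              - hessian f z $ i $ l * hessian f z $ j $ k = 0)}"

section \<open>The quadric, the quartic and the map between them\<close>

text \<open>The homogeneous coordinates $Z_0, \dots, Z_3$ are indexed by the elements \<open>0, 1, 2, 3\<close> of the
  type \<open>4\<close> of integers modulo 4. (The library's \<open>vector [a, b, c, d]\<close> has components
  \<open>1, 2, 3, 4 = 0\<close> in this order, and is therefore not used.)\<close>

definition pt :: "complex \<Rightarrow> complex \<Rightarrow> complex \<Rightarrow> complex \<Rightarrow> 4 cproj" where
  "pt a b c d = abs_cproj (\<chi> i. if i = 0 then a else if i = 1 then b else if i = 2 then c else d)"

definition quadric_Q :: "4 cproj set" where
  "quadric_Q = hypersurface (\<lambda>Z. Z $ 0 * Z $ 3 - Z $ 1 * Z $ 2)"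

definition poly_K :: "complex^4 \<Rightarrow> complex" where
  "poly_K Z = (Z $ 1 * Z $ 2 - Z $ 0 * Z $ 3)\<^sup>2 + 2 * Z $ 0 * Z $ 1 * (Z $ 1 * Z $ 2 + Z $ 0 * Z $ 3)"

definition surface_K :: "4 cproj set" where
  "surface_K = hypersurface poly_K"

definition line_m :: "4 \<Rightarrow> 4 \<Rightarrow> 4 cproj set" where
  "line_m k l = {abs_cproj Z | Z. Z \<noteq> 0 \<and> Z $ k = 0 \<and> Z $ l = 0}"

text \<open>Only the values of \<open>map_F\<close> on the quadric are meaningful. That they are well defined, i.e.
  independent of the homogeneous coordinates \<open>[s, v], [t, u]\<close>, needs proof.\<close>

definition map_F :: "4 cproj \<Rightarrow> 4 cproj" where
  "map_F p = (THE q. \<exists>s v t u. (s, v) \<noteq> (0, 0) \<and> (t, u) \<noteq> (0, 0) \<and>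
     p = pt (s * t) (s * u) (t * v) (u * v) \<and>
     q = pt (s\<^sup>2 * t) (s\<^sup>2 * u) (t * (v\<^sup>2 + \<i> * s * v)) (u * (v\<^sup>2 - \<i> * s * v)))"

end

theory Submission
  imports Defs
begin

text \<open>Every point of \<open>\<K>\<close> has homogeneous coordinates of the form \<open>F(s, v, t, u)\<close>: for
  $(Z_0, Z_1) \neq 0$ take \<open>s = 1\<close>, $t = Z_0$, $u = Z_1$ and solve for \<open>v\<close> the equations
  $v^2 + iv = Z_2/Z_0$, $v^2 - iv = Z_3/Z_1$, whose compatibility is \<open>K = 0\<close>. If \<open>t\<close> and \<open>u\<close> are
  nonzero, their difference gives $v = (Z_1Z_2 - Z_0Z_3)/(2iZ_0Z_1)$, which is the rational inverse
  of \<open>F\<close>. If \<open>t\<close> or \<open>u\<close> vanishes, only one quadratic equation remains; after completing the square,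
  \<open>F\<close> is \<open>w \<mapsto> w\<^sup>2\<close> on the Riemann sphere. The singular points and cusps are read off
  from the first and second derivatives of \<open>K\<close>.\<close>

section \<open>Topologies on projective space\<close>

text \<open>F has bidegree (2,1) in ((s,v),(t,u)), whereas a form of degree d in Z restricts to
  bidegree (d,d) on Q. Multiplying F by t or by u evens out the degrees and yields quadratic forms
  in Z; these give both independence of the coordinates and regularity. Zariski density is reached
  through the finer quotient topology: it is enough to move each point along a continuous curve into
  the given set, which takes the place of an irreducibility argument. The set is Z_0 Z_1 <> 0, which
  on both surfaces means s, t, u <> 0, and the curves shift these three parameters. The inverse
  formula breaks down for s = 0, but those points form m_01, which F fixes pointwise; this closes
  the gap in injectivity. The branch values of w |-> w^2 are 0 and infinity. On m_02 they are
  [0,1,0,1/4] and [0,0,0,1], on m_13 they are [1,0,1/4,0] and [0,0,1,0]: exactly the cusp points on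
  these two lines.\<close>

lemma abs_cproj_eq_iff:
  assumes "x \<noteq> 0" "y \<noteq> 0"
  shows "abs_cproj x = abs_cproj y \<longleftrightarrow> (\<exists>c. c \<noteq> 0 \<and> y = c *s x)"
proof -
  have "cproj_rel x x" "cproj_rel y y"
    using assms unfolding cproj_rel_def by (auto intro!: exI[of _ 1])
  then show ?thesis
    using Quotient3_rel[OF Quotient3_cproj, of x y] assms unfolding cproj_rel_def by auto
qed

lemma abs_cproj_smult:
  assumes "x \<noteq> 0" "c \<noteq> 0"
  shows "abs_cproj (c *s x) = abs_cproj x"
  using assms abs_cproj_eq_iff[of x "c *s x"] by auto

lemma rep_cproj_nonzero: "rep_cproj p \<noteq> 0"
  using Quotient3_rep_reflp[OF Quotient3_cproj, of p] unfolding cproj_rel_def by auto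

lemma abs_rep_cproj: "abs_cproj (rep_cproj p) = p"
  using Quotient3_abs_rep[OF Quotient3_cproj] .

lemma rep_abs_cproj:
  assumes "z \<noteq> 0"
  obtains c where "c \<noteq> 0" "rep_cproj (abs_cproj z) = c *s z"
  using abs_cproj_eq_iff[OF assms rep_cproj_nonzero, of "abs_cproj z"] by (auto simp: abs_rep_cproj)

lemma cproj_cases:
  obtains z where "z \<noteq> 0" "p = abs_cproj z"
  using rep_cproj_nonzero abs_rep_cproj by metis

lemma open_cproj_iff: "open U \<longleftrightarrow> open {z. z \<noteq> 0 \<and> abs_cproj z \<in> U}"
  by (rule open_cproj_def)

lemma continuous_on_abs_cproj: "continuous_on (- {0}) abs_cproj"
  unfolding continuous_on_open_vimage[OF open_Compl[OF closed_singleton]]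
proof (intro allI impI)
  fix B :: "'a cproj set" assume "open B"
  moreover have "abs_cproj -` B \<inter> - {0} = {z. z \<noteq> 0 \<and> abs_cproj z \<in> B}" by auto
  ultimately show "open (abs_cproj -` B \<inter> - {0})" by (simp add: open_cproj_iff)
qed

text \<open>Over an open set the projection from nonzero vectors is still a quotient map, so
  continuity can be tested in homogeneous coordinates.\<close>

lemma continuous_on_cproj:
  fixes f :: "'n::finite cproj \<Rightarrow> 'b::topological_space"
  assumes "open U" "continuous_on {z. z \<noteq> 0 \<and> abs_cproj z \<in> U} (\<lambda>z. f (abs_cproj z))"
  shows "continuous_on U f"
  unfolding continuous_on_open_vimage[OF assms(1)]
proof (intro allI impI)
  fix B :: "'b set" assume "open B"
  have o: "open {z. z \<noteq> 0 \<and> abs_cproj z \<in> U}" using assms(1) by (simp add: open_cproj_iff)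
  have "open ((\<lambda>z. f (abs_cproj z)) -` B \<inter> {z. z \<noteq> 0 \<and> abs_cproj z \<in> U})"
    using assms(2) \<open>open B\<close> unfolding continuous_on_open_vimage[OF o] by blast
  moreover have "(\<lambda>z. f (abs_cproj z)) -` B \<inter> {z. z \<noteq> 0 \<and> abs_cproj z \<in> U} =
      {z. z \<noteq> 0 \<and> abs_cproj z \<in> f -` B \<inter> U}" by auto
  ultimately show "open (f -` B \<inter> U)" by (simp add: open_cproj_iff)
qed

section \<open>Homogeneous polynomials\<close>

lemma homogeneous_poly_smult:
  "homogeneous_poly d f \<Longrightarrow> f (c *s z) = c ^ d * f z"
  by (induction rule: homogeneous_poly.induct) (auto simp: algebra_simps power_add)

lemma continuous_on_homogeneous_poly:
  "homogeneous_poly d f \<Longrightarrow> continuous_on S f"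
  by (induction rule: homogeneous_poly.induct) (auto intro!: continuous_intros)

lemma homogeneous_poly_cmult:
  "homogeneous_poly d f \<Longrightarrow> homogeneous_poly d (\<lambda>z. c * f z)"
  using homogeneous_poly.mult[OF homogeneous_poly.const[of c]] by simp

lemma homogeneous_poly_diff:
  assumes "homogeneous_poly d f" "homogeneous_poly d g"
  shows "homogeneous_poly d (\<lambda>z. f z - g z)"
  using homogeneous_poly.add[OF assms(1) homogeneous_poly_cmult[OF assms(2), of "-1"]] by simp

text \<open>The degree has the form \<open>Suc d\<close> so that a numeral unfolded to successors
  drives the derivation; with \<open>mult\<close> a splitting \<open>d + e\<close> would have to be
  guessed. This is also why later monomials are bracketed to the right.\<close>

lemma homogeneous_poly_coord_mult:
  assumes "homogeneous_poly d f"
  shows "homogeneous_poly (Suc d) (\<lambda>z. z $ i * f z)"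
  using homogeneous_poly.mult[OF homogeneous_poly.coord assms] by simp

lemma homogeneous_poly_coord: "homogeneous_poly (Suc 0) (\<lambda>z. z $ i)"
  using homogeneous_poly.coord[of i] by simp

lemmas homogeneous_poly_intros =
  homogeneous_poly_cmult homogeneous_poly_diff homogeneous_poly.add homogeneous_poly_coord_mult homogeneous_poly_coord

section \<open>Zariski open sets and Zariski density\<close>

lemma abs_cproj_in_nonvanishing_iff:
  assumes "homogeneous_poly d f" "z \<noteq> 0"
  shows "abs_cproj z \<in> {abs_cproj z | z. z \<noteq> 0 \<and> f z \<noteq> 0} \<longleftrightarrow> f z \<noteq> 0"
proof -
  have "f z \<noteq> 0" if w: "abs_cproj z = abs_cproj w" "w \<noteq> 0" "f w \<noteq> 0" for w
  proof -
    obtain c where "w = c *s z" using abs_cproj_eq_iff[of z w] w assms(2) by blast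
    then show ?thesis using homogeneous_poly_smult[OF assms(1), of c z] w by auto
  qed
  then show ?thesis using assms(2) by auto
qed

lemma openin_zariski_nonvanishing:
  assumes "homogeneous_poly d f"
  shows "openin zariski {abs_cproj z | z. z \<noteq> 0 \<and> f z \<noteq> 0}"
  unfolding zariski_def by (rule topology_generated_by_Basis) (use assms in blast)

lemma topspace_zariski: "topspace zariski = UNIV"
proof -
  have "{abs_cproj z | z. z \<noteq> 0 \<and> (1::complex) \<noteq> 0} = (UNIV :: 'a cproj set)"
    by (auto simp: set_eq_iff intro: cproj_cases)
  then have "openin zariski (UNIV :: 'a cproj set)"
    using openin_zariski_nonvanishing[OF homogeneous_poly.const[of 1], where ?'a='a] by metis
  then show ?thesis using openin_subset by fastforce
qed

lemma openin_zariski_imp_open: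
  assumes "openin zariski U"
  shows "open U"
proof -
  have "generate_topology_on {{abs_cproj z | z. z \<noteq> 0 \<and> f z \<noteq> 0} | f. \<exists>d. homogeneous_poly d f} U"
    using assms unfolding zariski_def by (rule openin_topology_generated_by)
  then show ?thesis
  proof (induction rule: generate_topology_on.induct)
    case (Basis s)
    then obtain f d where f: "homogeneous_poly d f" "s = {abs_cproj z | z. z \<noteq> 0 \<and> f z \<noteq> 0}"
      by blast
    have "{z. z \<noteq> 0 \<and> abs_cproj z \<in> s} = {z. z \<noteq> 0 \<and> f z \<noteq> 0}"
      using abs_cproj_in_nonvanishing_iff[OF f(1)] f(2) by blast
    moreover have "open {z. z \<noteq> 0 \<and> f z \<noteq> 0}"
      by (intro open_Collect_conj open_Collect_neq continuous_on_homogeneous_poly[OF f(1)] continuous_intros)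
    ultimately show ?case by (simp add: open_cproj_iff)
  qed (auto)
qed

text \<open>The Zariski topology is coarser than the quotient topology, in which density can be
  tested along curves.\<close>

lemma zariski_open_dense_inI:
  fixes X :: "'n::finite cproj set"
  assumes "openin zariski W" "U = X \<inter> W"
    and "\<And>p. p \<in> X \<Longrightarrow> \<exists>h :: complex \<Rightarrow> complex^'n. continuous_on UNIV h \<and> h 0 \<noteq> 0 \<and> p = abs_cproj (h 0) \<and>
           (\<forall>\<^sub>F e in at 0. h e \<noteq> 0 \<longrightarrow> abs_cproj (h e) \<in> U)"
  shows "zariski_open_dense_in X U"
  unfolding zariski_open_dense_in_def
proof
  show "openin (subtopology zariski X) U"
    using assms(1,2) by (auto simp: openin_subtopology)
  have "X \<subseteq> subtopology zariski X closure_of U"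
  proof
    fix p assume "p \<in> X"
    from assms(3)[OF this] obtain h :: "complex \<Rightarrow> complex^'n" where h: "continuous_on UNIV h" "h 0 \<noteq> 0"
      "p = abs_cproj (h 0)" "\<forall>\<^sub>F e in at 0. h e \<noteq> 0 \<longrightarrow> abs_cproj (h e) \<in> U" by blast
    have "\<exists>y. y \<in> U \<and> y \<in> T" if T: "p \<in> T" "openin (subtopology zariski X) T" for T
    proof -
      obtain T' where T': "openin zariski T'" "T = T' \<inter> X" using T(2) by (auto simp: openin_subtopology)
      have "open {z. z \<noteq> 0 \<and> abs_cproj z \<in> T'}"
        using openin_zariski_imp_open[OF T'(1)] by (simp add: open_cproj_iff)
      moreover have "(h \<longlongrightarrow> h 0) (at 0)" using h(1) by (simp add: continuous_on_def)
      ultimately have "\<forall>\<^sub>F e in at 0. h e \<in> {z. z \<noteq> 0 \<and> abs_cproj z \<in> T'}"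
        using h T(1) T'(2) by (auto dest: topological_tendstoD)
      with h(4) have "\<forall>\<^sub>F e in at 0. abs_cproj (h e) \<in> T' \<inter> U" by eventually_elim auto
      \<comment> \<open>0 is not isolated in the complex plane, so the punctured neighbourhoods of 0
        are nonempty and supply a parameter.\<close>
      then obtain e where "abs_cproj (h e) \<in> T' \<inter> U"
        using eventually_happens by (metis at_neq_bot trivial_limit_def)
      then show ?thesis using T' assms(2) by auto
    qed
    then show "p \<in> subtopology zariski X closure_of U"
      using \<open>p \<in> X\<close> by (auto simp: in_closure_of topspace_zariski)
  qed
  then show "subtopology zariski X closure_of U = X"
    using closure_of_subset_topspace[of "subtopology zariski X" U] by (auto simp: topspace_zariski)
qed

lemma zariski_open_dense_in_self: "zariski_open_dense_in X X"
  unfolding zariski_open_dense_in_def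
  by (metis closure_of_topspace openin_topspace topspace_subtopology topspace_zariski Int_UNIV_left)

section \<open>The branched covering $w \mapsto w^2$ of the sphere\<close>

text \<open>The homeomorphisms carry evenly covered sets and their sheets along: over the image of
  \<open>T\<close> under \<open>k\<close> the sheets are the images of the old ones under
  \<open>h\<close>. This moves the squaring map of the punctured plane to the projective
  lines.\<close>

lemma covering_space_transfer:
  assumes cov: "covering_space C p D"
    and h: "homeomorphism C C' h h'" and k: "homeomorphism D D' k k'"
    and f: "\<And>x. x \<in> C \<Longrightarrow> f (h x) = k (p x)"
  shows "covering_space C' f D'"
proof
  have pC: "p ` C = D" and pc: "continuous_on C p"
    using cov by (auto simp: covering_space_def)
  have hC: "h ` C = C'" and kD: "k ` D = D'" using h k by (auto simp: homeomorphism_def)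
  show "f ` C' = D'"
  proof -
    have "f ` C' = (\<lambda>x. f (h x)) ` C" using hC by auto
    also have "\<dots> = k ` p ` C" using f by (auto simp: image_iff)
    finally show ?thesis by (simp add: pC kD)
  qed
  have "continuous_on C' (k \<circ> p \<circ> h')"
    using h k pc pC by (intro continuous_on_compose) (auto simp: homeomorphism_def)
  moreover have "f y = (k \<circ> p \<circ> h') y" if "y \<in> C'" for y
    using that h f[of "h' y"] by (auto simp: homeomorphism_def)
  ultimately show "continuous_on C' f" by (simp cong: continuous_on_cong)
  fix x assume "x \<in> D'"
  then have "k' x \<in> D" using k by (auto simp: homeomorphism_def)
  then obtain T v where T: "k' x \<in> T" "openin (top_of_set D) T" "\<Union>v = C \<inter> p -` T"
      "\<And>u. u \<in> v \<Longrightarrow> openin (top_of_set C) u" "pairwise disjnt v"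
      "\<And>u. u \<in> v \<Longrightarrow> \<exists>q. homeomorphism u T p q"
    using cov unfolding covering_space_def by metis
  have TD: "T \<subseteq> D" using T(2) openin_imp_subset by blast
  have uC: "u \<subseteq> C" if "u \<in> v" for u using T(4)[OF that] openin_imp_subset by blast
  have inj: "inj_on h C" using h by (metis homeomorphism_apply1 inj_onI)
  have injk: "inj_on k D" using k by (metis homeomorphism_apply1 inj_onI)
  show "\<exists>T. x \<in> T \<and> openin (top_of_set D') T \<and>
             (\<exists>v. \<Union> v = C' \<inter> f -` T \<and> (\<forall>u\<in>v. openin (top_of_set C') u) \<and>
                  disjoint v \<and> (\<forall>u\<in>v. \<exists>q. homeomorphism u T f q))"
  proof (intro exI[of _ "k ` T"] exI[of _ "(`) h ` v"] conjI ballI)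
    show "x \<in> k ` T" using T(1) k \<open>x \<in> D'\<close> by (metis homeomorphism_apply2 image_eqI)
    show "openin (top_of_set D') (k ` T)" using homeomorphism_imp_open_map[OF k T(2)] .
    have "\<Union> ((`) h ` v) = h ` \<Union> v" by auto
    also have "\<dots> = h ` (C \<inter> p -` T)" using T(3) by simp
    also have "\<dots> = C' \<inter> f -` k ` T"
    proof (intro set_eqI iffI)
      fix y assume "y \<in> C' \<inter> f -` k ` T"
      then obtain c t where c: "c \<in> C" "y = h c" "t \<in> T" "f y = k t" using hC by auto
      then have "p c = t" using f[of c] injk TD pC by (metis imageI inj_onD subsetD)
      then show "y \<in> h ` (C \<inter> p -` T)" using c by auto
    qed (use f hC in auto)
    finally show "\<Union> ((`) h ` v) = C' \<inter> f -` k ` T" .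
    show "disjoint ((`) h ` v)"
    proof (rule pairwiseI)
      fix a b assume "a \<in> (`) h ` v" "b \<in> (`) h ` v" "a \<noteq> b"
      then obtain a' b' where ab: "a' \<in> v" "b' \<in> v" "a' \<noteq> b'" "a = h ` a'" "b = h ` b'" by auto
      then have "a' \<inter> b' = {}" using T(5) by (auto simp: pairwise_def disjnt_def)
      then show "disjnt a b"
        using inj_on_image_Int[OF inj uC[OF ab(1)] uC[OF ab(2)]] ab by (simp add: disjnt_def)
    qed
    fix u' assume "u' \<in> (`) h ` v"
    then obtain u where u: "u \<in> v" "u' = h ` u" by auto
    show "openin (top_of_set C') u'" using homeomorphism_imp_open_map[OF h T(4)[OF u(1)]] u by simp
    obtain q where q: "homeomorphism u T p q" using T(6)[OF u(1)] by blast
    have hu: "homeomorphism u' u h' h"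
      using homeomorphism_of_subsets[OF h uC[OF u(1)] subset_refl refl] u homeomorphism_sym by blast
    have kT: "homeomorphism T (k ` T) k k'"
      by (rule homeomorphism_of_subsets[OF k TD subset_refl refl])
    have kph: "homeomorphism u' (k ` T) (k \<circ> (p \<circ> h')) ((h \<circ> q) \<circ> k')"
      by (intro homeomorphism_compose[OF _ kT] homeomorphism_compose[OF hu q])
    have "f y = (k \<circ> (p \<circ> h')) y" if "y \<in> u'" for y
      using that u f uC[OF u(1)] h by (auto simp: homeomorphism_def subset_iff)
    then have "homeomorphism u' (k ` T) f ((h \<circ> q) \<circ> k')"
      by (intro homeomorphism_cong[OF kph refl refl]) auto
    then show "\<exists>q. homeomorphism u' (k ` T) f q" by blast
  qed
qed

text \<open>By invariance of domain the injective continuous \<open>E\<close> is an open embedding,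
  so composing it with the affine parametrisation \<open>e\<close> gives a coordinate disc of
  \<open>S\<close>.\<close>

lemma chart_disc:
  fixes e :: "complex \<Rightarrow> 'a::topological_space"
  assumes e: "homeomorphism UNIV (range e) e g" "openin (top_of_set S) (range e)"
    and E: "continuous_on (ball 0 1) E" "inj_on E (ball (0::complex) 1)"
  obtains \<phi> where "openin (top_of_set S) ((e \<circ> E) ` ball 0 1)"
    "homeomorphism ((e \<circ> E) ` ball 0 1) (ball 0 1) \<phi> (e \<circ> E)"
proof -
  obtain q where q: "homeomorphism (ball 0 1) (E ` ball 0 1) E q"
    by (rule invariance_of_domain_homeomorphism[OF open_ball E(1) _ E(2)]) auto
  have "open (E ` ball 0 1)" using invariance_of_domain[OF E(1) open_ball E(2)] .
  then have "openin (top_of_set (range e)) (e ` E ` ball 0 1)"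
    by (intro homeomorphism_imp_open_map[OF e(1)]) simp
  then have 1: "openin (top_of_set S) ((e \<circ> E) ` ball 0 1)"
    using openin_trans[OF _ e(2)] by (simp add: image_comp)
  have "homeomorphism (E ` ball 0 1) (e ` E ` ball 0 1) e g"
    by (rule homeomorphism_of_subsets[OF e(1)]) auto
  from homeomorphism_compose[OF q this]
  have "homeomorphism ((e \<circ> E) ` ball 0 1) (ball 0 1) (q \<circ> g) (e \<circ> E)"
    unfolding image_comp by (rule homeomorphism_sym[THEN iffD1])
  with 1 show thesis by (rule that)
qed

text \<open>The last clause of \<open>branched_covering\<close> at a single point, split off so that
  it can be proved chart by chart.\<close>

definition power_in_discs :: "('a::topological_space \<Rightarrow> 'b::topological_space) \<Rightarrow> 'a set \<Rightarrow> 'b set \<Rightarrow> 'a \<Rightarrow> bool"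
  where
  "power_in_discs f S T x \<longleftrightarrow> (\<exists>U V k \<phi> \<phi>' \<psi> \<psi>'. x \<in> U \<and>
        openin (top_of_set S) U \<and> openin (top_of_set T) V \<and>
        homeomorphism U (ball (0::complex) 1) \<phi> \<phi>' \<and> \<phi> x = 0 \<and>
        homeomorphism V (ball (0::complex) 1) \<psi> \<psi>' \<and> \<psi> (f x) = 0 \<and>
        f ` U \<subseteq> V \<and> k \<ge> (1::nat) \<and> (\<forall>y\<in>U. \<psi> (f y) = \<phi> y ^ k))"

text \<open>The discs are given by their parametrisations \<open>e \<circ> E\<close> and
  \<open>e' \<circ> E'\<close> instead of their coordinates, which reduces the local form of
  \<open>f\<close> to one identity on the unit disc.\<close>

lemma power_in_discsI:
  fixes e :: "complex \<Rightarrow> 'a::topological_space" and e' :: "complex \<Rightarrow> 'b::topological_space"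
  assumes e: "homeomorphism UNIV (range e) e g" "openin (top_of_set S) (range e)"
    and e': "homeomorphism UNIV (range e') e' g'" "openin (top_of_set T) (range e')"
    and E: "continuous_on (ball 0 1) E" "inj_on E (ball (0::complex) 1)"
    and E': "continuous_on (ball 0 1) E'" "inj_on E' (ball (0::complex) 1)"
    and f: "\<And>z. norm z < 1 \<Longrightarrow> f (e (E z)) = e' (E' (z ^ k))" and k: "k \<ge> 1"
  shows "power_in_discs f S T (e (E 0))"
proof -
  obtain \<phi> where \<phi>: "openin (top_of_set S) ((e \<circ> E) ` ball 0 1)"
    "homeomorphism ((e \<circ> E) ` ball 0 1) (ball 0 1) \<phi> (e \<circ> E)" by (rule chart_disc[OF e E])
  obtain \<psi> where \<psi>: "openin (top_of_set T) ((e' \<circ> E') ` ball 0 1)"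
    "homeomorphism ((e' \<circ> E') ` ball 0 1) (ball 0 1) \<psi> (e' \<circ> E')" by (rule chart_disc[OF e' E'])
  have 1: "\<phi> (e (E z)) = z" if "norm z < 1" for z
    using homeomorphism_apply2[OF \<phi>(2), of z] that by simp
  have zk: "norm (z ^ k) < 1" if "norm z < 1" for z :: complex
    using that k by (simp add: norm_power power_less_one_iff)
  have 2: "\<psi> (f (e (E z))) = z ^ k" if "norm z < 1" for z
    using homeomorphism_apply2[OF \<psi>(2), of "z ^ k"] zk[OF that] f[OF that] by simp
  show ?thesis
    unfolding power_in_discs_def
  proof (intro exI[of _ "(e \<circ> E) ` ball 0 1"] exI[of _ "(e' \<circ> E') ` ball 0 1"] exI[of _ k]
      exI[of _ \<phi>] exI[of _ "e \<circ> E"] exI[of _ \<psi>] exI[of _ "e' \<circ> E'"] conjI)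
    show "f ` (e \<circ> E) ` ball 0 1 \<subseteq> (e' \<circ> E') ` ball 0 1"
    proof clarsimp
      fix z :: complex assume "norm z < 1"
      then show "f (e (E z)) \<in> (\<lambda>x. e' (E' x)) ` ball 0 1"
        using f[of z] zk[of z] by auto
    qed
    show "\<psi> (f (e (E 0))) = 0" using 2[of 0] k by simp
    show "\<phi> (e (E 0)) = 0" by (rule 1) simp
    show "e (E 0) \<in> (e \<circ> E) ` ball 0 1" by (rule image_eqI[of _ _ 0]) auto
    show "\<forall>y\<in>(e \<circ> E) ` ball 0 1. \<psi> (f y) = \<phi> y ^ k" by (simp add: 1 2)
  qed (rule \<phi> \<psi> k)+
qed

text \<open>At \<open>w = 0\<close> the affine coordinates already show the power 2. At
  \<open>w \<noteq> 0\<close> squaring is locally invertible: in the logarithmic coordinates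
  \<open>w * exp z\<close> and \<open>w\<^sup>2 * exp (2 * z)\<close> it is the identity, so the
  power is 1.\<close>

lemma square_power_in_discs:
  fixes e :: "complex \<Rightarrow> 'a::topological_space" and e' :: "complex \<Rightarrow> 'b::topological_space"
  assumes e: "homeomorphism UNIV (range e) e g" "openin (top_of_set S) (range e)"
    and e': "homeomorphism UNIV (range e') e' g'" "openin (top_of_set T) (range e')"
    and f: "\<And>w. f (e w) = e' (w\<^sup>2)"
  shows "power_in_discs f S T (e w)"
proof (cases "w = 0")
  case True
  show ?thesis
    using power_in_discsI[OF e e', where E="\<lambda>z. z" and E'="\<lambda>z. z" and k=2] f True by (auto simp: continuous_on_id)
next
  case False
  \<comment> \<open>For \<open>c\<close> = 1 (source) and \<open>c\<close> = 2 (target),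
    multiplication by \<open>c\<close> sends the unit disc into the strip of imaginary part below 2
    < pi in absolute value, on which exp is injective.\<close>
  have inj: "a = b" if "exp (c * a) = exp (c * b)" "norm a < 1" "norm b < 1" "c \<in> {1, 2}" for a b c :: complex
  proof -
    have "\<bar>Im (c * a)\<bar> < pi" if "norm a < 1" "c \<in> {1,2}" for a c :: complex
      using abs_Im_le_cmod[of a] that pi_gt3 by auto
    from this[of a c] this[of b c] that have "\<bar>Im (c * a) - Im (c * b)\<bar> < 2 * pi" by argo
    from exp_complex_eqI[OF this that(1)] have "c * a = c * b" .
    then show ?thesis using that by auto
  qed
  have "power_in_discs f S T (e (w * exp (1 * 0)))"
  proof (rule power_in_discsI[OF e e', where E="\<lambda>z. w * exp (1 * z)" and E'="\<lambda>z. w\<^sup>2 * exp (2 * z)" and k=1])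
    show "inj_on (\<lambda>z. w * exp (1 * z)) (ball 0 1)"
      using inj[of 1] False by (auto intro!: inj_onI)
    show "inj_on (\<lambda>z. w\<^sup>2 * exp (2 * z)) (ball 0 1)"
      using inj[of 2] False by (auto intro!: inj_onI)
    fix z show "f (e (w * exp (1 * z))) = e' (w\<^sup>2 * exp (2 * z ^ 1))"
      by (simp add: f power_mult_distrib exp_double)
  qed (auto intro!: continuous_intros)
  then show ?thesis by simp
qed

text \<open>The Riemann sphere as two copies of the plane glued along w' = 1/w. Since
  \<open>w * 0 = 1\<close> is impossible, \<open>glue\<close> also says that \<open>e1 0\<close> is
  the point at infinity, missed by \<open>e0\<close>.\<close>

locale sphere_charts =
  fixes S :: "'a::topological_space set" and e0 e1 :: "complex \<Rightarrow> 'a"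
  assumes hom0: "\<exists>g. homeomorphism UNIV (range e0) e0 g" and hom1: "\<exists>g. homeomorphism UNIV (range e1) e1 g"
    and open0: "openin (top_of_set S) (range e0)" and open1: "openin (top_of_set S) (range e1)"
    and cover: "S = range e0 \<union> range e1"
    and glue: "e0 w = e1 w' \<longleftrightarrow> w * w' = 1"
begin

lemma inj0: "e0 w = e0 w' \<longleftrightarrow> w = w'"
proof -
  obtain g where "homeomorphism UNIV (range e0) e0 g" using hom0 ..
  then have "g (e0 w) = w" "g (e0 w') = w'" by (auto simp: homeomorphism_def)
  then show ?thesis by metis
qed

lemma cases_sphere:
  assumes "x \<in> S"
  obtains w where "x = e0 w" | "x = e1 0"
proof -
  have "e1 w = e0 (inverse w)" if "w \<noteq> 0" for w using glue[of "inverse w" w] that by simp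
  moreover obtain w where "x = e0 w \<or> x = e1 w" using assms cover by auto
  ultimately show thesis using that by (cases "w = 0") auto
qed

lemma in_sphere: "e0 w \<in> S" "e1 w \<in> S"
  using cover by auto

end

text \<open>Squaring commutes with inversion, so the same formula holds in both charts and fixes 0
  and infinity. Away from these two points the map is the squaring covering of the punctured plane,
  read in \<open>e0\<close> and \<open>d0\<close>.\<close>

lemma branched_covering_square:
  assumes "sphere_charts S e0 e1" "sphere_charts T d0 d1"
    and f0: "\<And>w. f (e0 w) = d0 (w\<^sup>2)" and f1: "\<And>w. f (e1 w) = d1 (w\<^sup>2)"
  shows "branched_covering 2 f S T"
proof -
  interpret S: sphere_charts S e0 e1 by fact
  interpret T: sphere_charts T d0 d1 by fact
  obtain g0 g1 h0 h1 where hom: "homeomorphism UNIV (range e0) e0 g0" "homeomorphism UNIV (range e1) e1 g1"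
     "homeomorphism UNIV (range d0) d0 h0" "homeomorphism UNIV (range d1) d1 h1"
    using S.hom0 S.hom1 T.hom0 T.hom1 by blast
  have cont: "continuous_on (range e) f"
    if "homeomorphism UNIV (range e) e g" "homeomorphism UNIV (range d) d h" "\<And>w. f (e w) = d (w\<^sup>2)"
    for e :: "complex \<Rightarrow> 'a" and d :: "complex \<Rightarrow> 'b" and g h
  proof -
    have g: "continuous_on (range e) g" "\<And>w. g (e w) = w" and d: "continuous_on UNIV d"
      using that by (auto simp: homeomorphism_def)
    have "continuous_on (range e) (\<lambda>x. d ((g x)\<^sup>2))"
      by (rule continuous_on_compose2[OF d]) (auto intro!: continuous_intros g)
    moreover have "d ((g x)\<^sup>2) = f x" if "x \<in> range e" for x
      using that g \<open>\<And>w. f (e w) = d (w\<^sup>2)\<close> by auto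
    ultimately show ?thesis by (simp cong: continuous_on_cong)
  qed
  have "continuous_on (range e0 \<union> range e1) f"
    using cont[OF hom(1,3) f0] cont[OF hom(2,4) f1] S.open0 S.open1 S.cover
    by (intro continuous_on_Un_local_open) auto
  then have 1: "continuous_on S f" by (simp add: S.cover)
  have sq: "\<exists>r. w = r\<^sup>2" for w :: complex by (metis power2_csqrt)
  have 2: "f ` S = T"
  proof
    show "f ` S \<subseteq> T" using S.cover T.cover f0 f1 by auto
    show "T \<subseteq> f ` S"
    proof
      fix y assume "y \<in> T"
      then obtain w where "y = d0 w \<or> y = d1 w" using T.cover by auto
      moreover obtain r where "w = r\<^sup>2" using sq by blast
      ultimately have "y = f (e0 r) \<or> y = f (e1 r)" using f0 f1 by simp
      then show "y \<in> f ` S" using S.in_sphere by blast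
    qed
  qed
  \<comment> \<open>The two branch values, 0 and infinity.\<close>
  define B where "B = {d0 0, d1 0}"
  have d01: "d0 w \<noteq> d1 0" for w using T.glue[of w 0] by simp
  have fib: "f (e0 w) \<in> B \<longleftrightarrow> w = 0" "f (e1 0) \<in> B" for w
    using d01 T.inj0 f0 f1[of 0] by (auto simp: B_def)
  have SB: "S - f -` B = e0 ` (- {0})"
    using fib S.in_sphere by (auto elim!: S.cases_sphere)
  have TB: "T - B = d0 ` (- {0})"
    using T.in_sphere d01 T.inj0 by (auto simp: B_def elim!: T.cases_sphere)
  have cov: "covering_space (S - f -` B) f (T - B)"
    unfolding SB TB
  proof (rule covering_space_transfer[OF covering_space_square_punctured_plane])
    show "homeomorphism (- {0}) (e0 ` (- {0})) e0 g0" "homeomorphism (- {0}) (d0 ` (- {0})) d0 h0"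
      by (rule homeomorphism_of_subsets[OF hom(1)] homeomorphism_of_subsets[OF hom(3)]; auto)+
  qed (use f0 in auto)
  have card: "finite {x \<in> S. f x = y} \<and> card {x \<in> S. f x = y} = 2" if "y \<in> T - B" for y
  proof -
    obtain r where r: "y = d0 (r\<^sup>2)" "r \<noteq> 0" using \<open>y \<in> T - B\<close> TB sq by (metis ComplD image_iff power_zero_numeral singletonI)
    have "{x \<in> S. f x = y} = {e0 r, e0 (- r)}"
      using S.in_sphere r f0 f1[of 0] T.inj0 d01 not_sym[OF d01]
      by (auto simp: power2_eq_iff elim!: S.cases_sphere)
    moreover have "e0 r \<noteq> e0 (- r)" using S.inj0 r by simp
    ultimately show ?thesis by simp
  qed
  have "power_in_discs f S T x" if "x \<in> S" for x
    using that square_power_in_discs[OF hom(1) S.open0 hom(3) T.open0 f0]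
      square_power_in_discs[OF hom(2) S.open1 hom(4) T.open1 f1] S.cover by auto
  moreover have "finite B" "B \<subseteq> T" using T.in_sphere by (auto simp: B_def)
  ultimately show ?thesis
    unfolding branched_covering_def power_in_discs_def[symmetric]
    using 1 2 cov card by blast
qed

section \<open>Projective lines\<close>

text \<open>The scalar between two representatives cancels because both degrees are
  \<open>d\<close>. Where \<open>g\<close> vanishes, it vanishes at both representatives, and both
  quotients are 0.\<close>

lemma homogeneous_ratio_rep:
  assumes "homogeneous_poly d f" "homogeneous_poly d g" "z \<noteq> 0"
  shows "f (rep_cproj (abs_cproj z)) / g (rep_cproj (abs_cproj z)) = f z / g z"
proof -
  obtain c where "c \<noteq> 0" "rep_cproj (abs_cproj z) = c *s z"
    by (rule rep_abs_cproj[OF assms(3)])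
  then show ?thesis
    using homogeneous_poly_smult[OF assms(1), of c z] homogeneous_poly_smult[OF assms(2), of c z] by simp
qed

text \<open>\<open>\<alpha>\<close> and \<open>\<beta>\<close> are coordinate forms dual to
  \<open>A\<close> and \<open>B\<close>, so the ratio of \<open>\<beta>\<close> to
  \<open>\<alpha>\<close> is a continuous inverse of the parametrisation on the open set where
  \<open>\<alpha>\<close> does not vanish.\<close>

lemma projective_line_chart:
  fixes A B :: "complex^'n::finite"
  assumes hom: "homogeneous_poly 1 \<alpha>" "homogeneous_poly 1 \<beta>"
    and \<alpha>: "\<And>a b. \<alpha> (a *s A + b *s B) = a" and \<beta>: "\<And>a b. \<beta> (a *s A + b *s B) = b"
    and S: "S = {abs_cproj (a *s A + b *s B) | a b. (a, b) \<noteq> (0, 0)}"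
  shows "\<exists>g. homeomorphism UNIV (range (\<lambda>w. abs_cproj (A + w *s B))) (\<lambda>w. abs_cproj (A + w *s B)) g"
    and "openin (top_of_set S) (range (\<lambda>w. abs_cproj (A + w *s B)))"
proof -
  define e where "e w = abs_cproj (A + w *s B)" for w
  define W where "W = {abs_cproj z | z. z \<noteq> 0 \<and> \<alpha> z \<noteq> 0}"
  define g where "g p = \<beta> (rep_cproj p) / \<alpha> (rep_cproj p)" for p
  have \<alpha>0: "\<alpha> 0 = 0" using \<alpha>[of 0 0] by simp
  have \<alpha>1: "\<alpha> (A + w *s B) = 1" and \<beta>1: "\<beta> (A + w *s B) = w" for w
    using \<alpha>[of 1 w] \<beta>[of 1 w] by simp_all
  have nz: "A + w *s B \<noteq> 0" for w using \<alpha>1[of w] \<alpha>0 by auto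
  have opW: "open W" unfolding W_def by (rule openin_zariski_imp_open[OF openin_zariski_nonvanishing[OF hom(1)]])
  have inW: "abs_cproj z \<in> W \<longleftrightarrow> \<alpha> z \<noteq> 0" if "z \<noteq> 0" for z
    unfolding W_def using abs_cproj_in_nonvanishing_iff[OF hom(1) that] .
  have g: "g (abs_cproj z) = \<beta> z / \<alpha> z" if "z \<noteq> 0" for z
    unfolding g_def by (rule homogeneous_ratio_rep[OF hom(2,1) that])
  have "continuous_on {z. z \<noteq> 0 \<and> abs_cproj z \<in> W} (\<lambda>z. \<beta> z / \<alpha> z)"
    using inW by (intro continuous_intros continuous_on_homogeneous_poly[OF hom(1)]
        continuous_on_homogeneous_poly[OF hom(2)]) auto
  then have "continuous_on {z. z \<noteq> 0 \<and> abs_cproj z \<in> W} (\<lambda>z. g (abs_cproj z))"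
    by (rule continuous_on_cong[THEN iffD1, rotated -1]) (auto simp: g)
  then have cg: "continuous_on W g" by (rule continuous_on_cproj[OF opW])
  have ce: "continuous_on UNIV e"
    unfolding e_def
    by (intro continuous_on_compose2[OF continuous_on_abs_cproj])
      (use nz in \<open>auto simp: vector_scalar_mult_def intro!: continuous_intros continuous_on_vec_lambda\<close>)
  have ge: "g (e w) = w" for w unfolding e_def by (simp add: g[OF nz] \<alpha>1 \<beta>1)
  have rW: "range e \<subseteq> W" using inW[OF nz] \<alpha>1 by (auto simp: e_def)
  have r: "range e = S \<inter> W"
  proof
    show "range e \<subseteq> S \<inter> W"
    proof -
      have "e w \<in> S" for w
        unfolding S mem_Collect_eq by (intro exI[of _ 1] exI[of _ w]) (simp add: e_def)
      then show ?thesis using rW by auto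
    qed
    show "S \<inter> W \<subseteq> range e"
    proof
      fix p assume p: "p \<in> S \<inter> W"
      then obtain a b where ab: "p = abs_cproj (a *s A + b *s B)" "(a, b) \<noteq> (0, 0)" by (auto simp: S)
      have "a *s A + b *s B \<noteq> 0"
        using ab(2) \<alpha>[of a b] \<beta>[of a b] \<alpha>[of 0 0] \<beta>[of 0 0] by auto
      with p have "a \<noteq> 0" using inW[of "a *s A + b *s B"] \<alpha>[of a b] ab(1) by simp
      then have "a *s A + b *s B = a *s (A + (b / a) *s B)"
        by (simp add: vec_eq_iff algebra_simps)
      then have "p = e (b / a)"
        unfolding ab(1) e_def by (simp only: abs_cproj_smult[OF nz \<open>a \<noteq> 0\<close>])
      then show "p \<in> range e" by blast
    qed
  qed
  have "homeomorphism UNIV (range e) e g"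
    using ce continuous_on_subset[OF cg rW] ge by (intro homeomorphismI) auto
  then show "\<exists>g. homeomorphism UNIV (range (\<lambda>w. abs_cproj (A + w *s B))) (\<lambda>w. abs_cproj (A + w *s B)) g"
    unfolding e_def by blast
  show "openin (top_of_set S) (range (\<lambda>w. abs_cproj (A + w *s B)))"
    using openin_open_Int[OF opW, of S] r by (simp add: e_def[abs_def])
qed

section \<open>Parametrisations of the quadric and of the quartic\<close>

text \<open>\<open>exhaust_4\<close> lists the indices 1, 2, 3, 4, and 4 = 0 in this type.\<close>

lemma forall_index_4: "(\<forall>i::4. P i) \<longleftrightarrow> P 0 \<and> P 1 \<and> P 2 \<and> P 3"
proof -
  have "i = 0 \<or> i = 1 \<or> i = 2 \<or> i = 3" for i :: 4
    using exhaust_4[of i] by auto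
  then show ?thesis by metis
qed

definition vec4 :: "complex \<Rightarrow> complex \<Rightarrow> complex \<Rightarrow> complex \<Rightarrow> complex^4" where
  "vec4 a b c d = (\<chi> i. if i = 0 then a else if i = 1 then b else if i = 2 then c else d)"

lemma pt_vec4: "pt a b c d = abs_cproj (vec4 a b c d)"
  by (simp add: pt_def vec4_def)

lemma vec4_nth [simp]:
  "vec4 a b c d $ 0 = a" "vec4 a b c d $ 1 = b" "vec4 a b c d $ 2 = c" "vec4 a b c d $ 3 = d"
  by (simp_all add: vec4_def)

lemma vec4_eq_iff: "x = y \<longleftrightarrow> x $ 0 = y $ 0 \<and> x $ 1 = y $ 1 \<and> x $ 2 = y $ 2 \<and> x $ 3 = y $ 3" for x y :: "complex^4"
  by (simp add: vec_eq_iff forall_index_4)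

lemma vec4_eq_0_iff [simp]: "vec4 a b c d = 0 \<longleftrightarrow> a = 0 \<and> b = 0 \<and> c = 0 \<and> d = 0"
  by (simp add: vec4_eq_iff)

lemma smult_vec4: "k *s vec4 a b c d = vec4 (k * a) (k * b) (k * c) (k * d)"
  by (simp add: vec4_eq_iff)

lemma plus_vec4: "vec4 a b c d + vec4 a' b' c' d' = vec4 (a + a') (b + b') (c + c') (d + d')"
  by (simp add: vec4_eq_iff)

lemma continuous_on_vec4:
  assumes "continuous_on S a" "continuous_on S b" "continuous_on S c" "continuous_on S d"
  shows "continuous_on S (\<lambda>x. vec4 (a x) (b x) (c x) (d x))"
  unfolding vec4_def
proof (intro continuous_on_vec_lambda)
  fix i :: 4
  show "continuous_on S (\<lambda>x. if i = 0 then a x else if i = 1 then b x else if i = 2 then c x else d x)"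
    using assms by (cases "i = 0"; cases "i = 1"; cases "i = 2") simp_all
qed

lemma homogeneous_poly_vec4:
  assumes "homogeneous_poly n a" "homogeneous_poly n b" "homogeneous_poly n c" "homogeneous_poly n d"
  shows "homogeneous_poly n (\<lambda>z. vec4 (a z) (b z) (c z) (d z) $ i)"
  unfolding vec4_def
  using assms by (cases "i = 0"; cases "i = 1"; cases "i = 2") simp_all

section \<open>Homogeneous parametrisations of Q and K\<close>

definition segre :: "complex \<Rightarrow> complex \<Rightarrow> complex \<Rightarrow> complex \<Rightarrow> complex^4" where
  "segre s v t u = vec4 (s * t) (s * u) (t * v) (u * v)"

definition lift_F :: "complex \<Rightarrow> complex \<Rightarrow> complex \<Rightarrow> complex \<Rightarrow> complex^4" where
  "lift_F s v t u = vec4 (s\<^sup>2 * t) (s\<^sup>2 * u) (t * (v\<^sup>2 + \<i> * s * v)) (u * (v\<^sup>2 - \<i> * s * v))"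

lemma segre_nonzero: "(s, v) \<noteq> (0, 0) \<Longrightarrow> (t, u) \<noteq> (0, 0) \<Longrightarrow> segre s v t u \<noteq> 0"
  by (auto simp: segre_def)

lemma lift_F_nonzero: "(s, v) \<noteq> (0, 0) \<Longrightarrow> (t, u) \<noteq> (0, 0) \<Longrightarrow> lift_F s v t u \<noteq> 0"
  by (auto simp: lift_F_def)

text \<open>With s = 1, t = Z_0, u = Z_1 the value v has to be Z_2/Z_0 and Z_3/Z_1, which agree by
  the equation of Q whenever both exist. The remaining points Z_0 = Z_1 = 0 have s = 0.\<close>

lemma quadric_param:
  assumes "z \<noteq> 0" "z $ 0 * z $ 3 = z $ 1 * z $ 2"
  obtains s v t u where "(s, v) \<noteq> (0, 0)" "(t, u) \<noteq> (0, 0)" "z = segre s v t u"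
proof (cases "z $ 0 = 0 \<and> z $ 1 = 0")
  case True
  then have "z = segre 0 1 (z $ 2) (z $ 3)" by (simp add: segre_def vec4_eq_iff)
  with True assms(1) show thesis by (intro that[of 0 1 "z $ 2" "z $ 3"]) (auto simp: vec4_eq_iff)
next
  case False
  define v where "v = (if z $ 0 = 0 then z $ 3 / z $ 1 else z $ 2 / z $ 0)"
  have "z = segre 1 v (z $ 0) (z $ 1)"
    using False assms(2) by (auto simp: segre_def vec4_eq_iff v_def field_simps)
  with False show thesis by (intro that[of 1 v "z $ 0" "z $ 1"]) auto
qed

lemma surface_param:
  assumes "z \<noteq> 0" "poly_K z = 0"
  obtains s v t u where "(s, v) \<noteq> (0, 0)" "(t, u) \<noteq> (0, 0)" "z = lift_F s v t u"
proof (cases "z $ 0 = 0 \<and> z $ 1 = 0")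
  case True
  then have "z = lift_F 0 1 (z $ 2) (z $ 3)" by (simp add: lift_F_def vec4_eq_iff)
  with True assms(1) show thesis by (intro that[of 0 1 "z $ 2" "z $ 3"]) (auto simp: vec4_eq_iff)
next
  case False
  have quadratic: "\<exists>v. v\<^sup>2 + b * v = c" for b c :: complex
  proof
    show "(csqrt (c + b\<^sup>2 / 4) - b / 2)\<^sup>2 + b * (csqrt (c + b\<^sup>2 / 4) - b / 2) = c"
    proof -
      have "(r - b / 2)\<^sup>2 + b * (r - b / 2) = r\<^sup>2 - b\<^sup>2 / 4" for r
        by (simp add: power2_eq_square field_simps)
      then show ?thesis by simp
    qed
  qed
  have "\<exists>v. z = lift_F 1 v (z $ 0) (z $ 1)"
  proof (cases "z $ 0 = 0 \<or> z $ 1 = 0")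
    case True
    then show ?thesis
    proof
      assume 0: "z $ 0 = 0"
      \<comment> \<open>For Z_0 = 0 the polynomial K is (Z_1 Z_2)^2.\<close>
      then have "z $ 2 = 0" using assms(2) False by (simp add: poly_K_def)
      moreover obtain v where "v\<^sup>2 + (- \<i>) * v = z $ 3 / z $ 1" using quadratic by blast
      ultimately show ?thesis using 0 False by (auto simp: lift_F_def vec4_eq_iff intro!: exI[of _ v])
    next
      assume 0: "z $ 1 = 0"
      then have "z $ 3 = 0" using assms(2) False by (simp add: poly_K_def)
      moreover obtain v where "v\<^sup>2 + \<i> * v = z $ 2 / z $ 0" using quadratic by blast
      ultimately show ?thesis using 0 False by (auto simp: lift_F_def vec4_eq_iff intro!: exI[of _ v])
    qed
  next
    case n: False
    define a b where "a = z $ 2 / z $ 0" and "b = z $ 3 / z $ 1"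
    define v where "v = (a - b) / (2 * \<i>)"
    have ab: "z $ 2 = a * z $ 0" "z $ 3 = b * z $ 1" using n by (auto simp: a_def b_def)
    \<comment> \<open>Dividing K by (Z_0 Z_1)^2 leaves an equation in the two quotients
      \<open>a\<close> and \<open>b\<close>. It says that half their sum is the square of the
      \<open>v\<close> obtained from half their difference.\<close>
    have "(z $ 0 * z $ 1)\<^sup>2 * ((a - b)\<^sup>2 + 2 * (a + b)) = 0"
      using assms(2) unfolding poly_K_def ab by (simp add: power2_eq_square algebra_simps)
    then have "(a - b)\<^sup>2 = - 2 * (a + b)" using n by (simp add: add_eq_0_iff2)
    then have "v\<^sup>2 = (a + b) / 2"
      by (simp add: v_def power_divide power_mult_distrib)
    moreover have "\<i> * v = (a - b) / 2" by (simp add: v_def field_simps)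
    ultimately have "v\<^sup>2 + \<i> * v = a" "v\<^sup>2 - \<i> * v = b"
      by (simp_all only:) (simp_all add: field_simps)
    then have "z = lift_F 1 v (z $ 0) (z $ 1)" by (simp add: lift_F_def vec4_eq_iff ab)
    then show ?thesis ..
  qed
  then obtain v where "z = lift_F 1 v (z $ 0) (z $ 1)" ..
  with False show thesis by (intro that[of 1 v "z $ 0" "z $ 1"]) auto
qed

lemma poly_K_lift_F: "poly_K (lift_F s v t u) = 0"
proof -
  \<comment> \<open>\<open>\<i>\<close> is hidden behind a name so that \<open>algebra\<close>
    treats it as an indeterminate subject only to \<open>c * c = -1\<close>.\<close>
  define c where "c = (\<i> :: complex)"
  have "c * c = -1" by (simp add: c_def)
  then show ?thesis
    unfolding lift_F_def poly_K_def vec4_nth c_def[symmetric] by algebra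
qed

lemma quadric_Q_cases:
  assumes "p \<in> quadric_Q"
  obtains s v t u where "(s, v) \<noteq> (0, 0)" "(t, u) \<noteq> (0, 0)" "p = abs_cproj (segre s v t u)"
proof -
  obtain z where z: "p = abs_cproj z" "z \<noteq> 0" "z $ 0 * z $ 3 = z $ 1 * z $ 2"
    using assms unfolding quadric_Q_def hypersurface_def by auto
  from z(2,3) obtain s v t u where "(s, v) \<noteq> (0, 0)" "(t, u) \<noteq> (0, 0)" "z = segre s v t u"
    by (rule quadric_param)
  then show thesis using that z(1) by simp
qed

lemma segre_in_quadric_Q:
  assumes "segre s v t u \<noteq> 0"
  shows "abs_cproj (segre s v t u) \<in> quadric_Q"
  unfolding quadric_Q_def hypersurface_def mem_Collect_eq
  using assms by (intro exI[of _ "segre s v t u"]) (simp add: segre_def)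

lemma surface_K_cases:
  assumes "p \<in> surface_K"
  obtains s v t u where "(s, v) \<noteq> (0, 0)" "(t, u) \<noteq> (0, 0)" "p = abs_cproj (lift_F s v t u)"
proof -
  obtain z where z: "p = abs_cproj z" "z \<noteq> 0" "poly_K z = 0"
    using assms unfolding surface_K_def hypersurface_def by auto
  from z(2,3) obtain s v t u where "(s, v) \<noteq> (0, 0)" "(t, u) \<noteq> (0, 0)" "z = lift_F s v t u"
    by (rule surface_param)
  then show thesis using that z(1) by simp
qed

lemma lift_F_in_surface_K:
  assumes "lift_F s v t u \<noteq> 0"
  shows "abs_cproj (lift_F s v t u) \<in> surface_K"
  unfolding surface_K_def hypersurface_def mem_Collect_eq
  using assms by (intro exI[of _ "lift_F s v t u"]) (simp add: poly_K_lift_F)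

text \<open>On the quadric, \<open>t\<close> (resp. \<open>u\<close>) times the formula for \<open>F\<close> is a quadratic form in the
  coordinates \<open>Z\<close> of \<open>\<complex>\<P>\<^sup>3\<close>.\<close>

definition chart_t :: "complex^4 \<Rightarrow> complex^4" where
  "chart_t z = vec4 (z $ 0 * z $ 0) (z $ 0 * z $ 1) (z $ 2 * z $ 2 + \<i> * (z $ 0 * z $ 2))
     (z $ 2 * z $ 3 - \<i> * (z $ 1 * z $ 2))"

definition chart_u :: "complex^4 \<Rightarrow> complex^4" where
  "chart_u z = vec4 (z $ 0 * z $ 1) (z $ 1 * z $ 1) (z $ 2 * z $ 3 + \<i> * (z $ 0 * z $ 3))
     (z $ 3 * z $ 3 - \<i> * (z $ 1 * z $ 3))"

lemma chart_segre: "chart_t (segre s v t u) = t *s lift_F s v t u"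
  "chart_u (segre s v t u) = u *s lift_F s v t u"
  by (simp_all add: chart_t_def chart_u_def segre_def lift_F_def vec4_eq_iff power2_eq_square algebra_simps)

lemma chart_smult: "chart_t (c *s z) = (c * c) *s chart_t z" "chart_u (c *s z) = (c * c) *s chart_u z"
  by (simp_all add: chart_t_def chart_u_def vec4_eq_iff algebra_simps)

text \<open>\<open>chart_t\<close> and \<open>chart_u\<close> depend only on the Segre vector, which
  changes by a scalar \<open>c\<close>. Their values are the multiples of \<open>lift_F\<close> by t
  and by u, so it suffices to compare in a chart whose factor is nonzero in both
  representations.\<close>

lemma abs_lift_F_well_defined:
  assumes "(s, v) \<noteq> (0, 0)" "(t, u) \<noteq> (0, 0)" "(s', v') \<noteq> (0, 0)" "(t', u') \<noteq> (0, 0)"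
    and "abs_cproj (segre s v t u) = abs_cproj (segre s' v' t' u')"
  shows "abs_cproj (lift_F s v t u) = abs_cproj (lift_F s' v' t' u')"
proof -
  obtain c where c: "c \<noteq> 0" "segre s' v' t' u' = c *s segre s v t u"
    using assms(5) abs_cproj_eq_iff[OF segre_nonzero[OF assms(1,2)] segre_nonzero[OF assms(3,4)]] by blast
  have eqs: "s' * t' = c * (s * t)" "t' * v' = c * (t * v)" "s' * u' = c * (s * u)" "u' * v' = c * (u * v)"
    using c(2) by (auto simp: segre_def vec4_eq_iff)
  have 1: "t' *s lift_F s' v' t' u' = (c * c * t) *s lift_F s v t u"
    "u' *s lift_F s' v' t' u' = (c * c * u) *s lift_F s v t u"
    using chart_segre[of s' v' t' u'] chart_segre[of s v t u]
      chart_smult[of c "segre s v t u"] c(2) by (simp_all)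
  \<comment> \<open>t = 0 means Z_0 = Z_2 = 0 and u = 0 means Z_1 = Z_3 = 0, conditions on the point
    alone.\<close>
  have "t' \<noteq> 0 \<longleftrightarrow> t \<noteq> 0" "u' \<noteq> 0 \<longleftrightarrow> u \<noteq> 0"
    using eqs c(1) assms by auto
  then have "t \<noteq> 0 \<and> t' \<noteq> 0 \<or> u \<noteq> 0 \<and> u' \<noteq> 0" using assms(2) by auto
  then obtain k l where kl: "k \<noteq> 0" "l \<noteq> 0" "l *s lift_F s' v' t' u' = k *s lift_F s v t u"
  proof
    assume "t \<noteq> 0 \<and> t' \<noteq> 0"
    then show thesis using 1(1) c(1) by (intro that[of "c * c * t" t']) simp_all
  next
    assume "u \<noteq> 0 \<and> u' \<noteq> 0"
    then show thesis using 1(2) c(1) by (intro that[of "c * c * u" u']) simp_all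
  qed
  show ?thesis
    using abs_cproj_smult[OF lift_F_nonzero[OF assms(1,2)] kl(1)]
      abs_cproj_smult[OF lift_F_nonzero[OF assms(3,4)] kl(2)] kl(3) by simp
qed

lemma map_F_segre:
  assumes "(s, v) \<noteq> (0, 0)" "(t, u) \<noteq> (0, 0)"
  shows "map_F (abs_cproj (segre s v t u)) = abs_cproj (lift_F s v t u)"
  unfolding map_F_def pt_vec4 segre_def[symmetric] lift_F_def[symmetric]
proof (rule the_equality)
  show "\<exists>s' v' t' u'. (s', v') \<noteq> (0, 0) \<and> (t', u') \<noteq> (0, 0) \<and>
      abs_cproj (segre s v t u) = abs_cproj (segre s' v' t' u') \<and>
      abs_cproj (lift_F s v t u) = abs_cproj (lift_F s' v' t' u')"
    by (intro exI[of _ s] exI[of _ v] exI[of _ t] exI[of _ u] conjI assms refl)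
next
  fix q
  assume "\<exists>s' v' t' u'. (s', v') \<noteq> (0, 0) \<and> (t', u') \<noteq> (0, 0) \<and>
      abs_cproj (segre s v t u) = abs_cproj (segre s' v' t' u') \<and> q = abs_cproj (lift_F s' v' t' u')"
  then obtain s' v' t' u' where "(s', v') \<noteq> (0, 0)" "(t', u') \<noteq> (0, 0)"
    "abs_cproj (segre s v t u) = abs_cproj (segre s' v' t' u')" "q = abs_cproj (lift_F s' v' t' u')"
    by (elim exE conjE)
  then show "q = abs_cproj (lift_F s v t u)" using abs_lift_F_well_defined[OF assms] by simp
qed

lemma map_F_image: "map_F ` quadric_Q = surface_K"
proof
  show "map_F ` quadric_Q \<subseteq> surface_K"
  proof (rule image_subsetI)
    fix p assume "p \<in> quadric_Q"
    then obtain s v t u where *: "(s, v) \<noteq> (0, 0)" "(t, u) \<noteq> (0, 0)" "p = abs_cproj (segre s v t u)"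
      by (rule quadric_Q_cases)
    then show "map_F p \<in> surface_K"
      using lift_F_in_surface_K[OF lift_F_nonzero[OF *(1,2)]] map_F_segre[OF *(1,2)] by simp
  qed
  show "surface_K \<subseteq> map_F ` quadric_Q"
  proof
    fix q assume "q \<in> surface_K"
    then obtain s v t u where *: "(s, v) \<noteq> (0, 0)" "(t, u) \<noteq> (0, 0)" "q = abs_cproj (lift_F s v t u)"
      by (rule surface_K_cases)
    then show "q \<in> map_F ` quadric_Q"
      using segre_in_quadric_Q[OF segre_nonzero[OF *(1,2)]] map_F_segre[OF *(1,2)] by (metis imageI)
  qed
qed

section \<open>The rational inverse\<close>

lemma abs_cproj_coord_0_iff:
  assumes "z \<noteq> 0" "w \<noteq> 0" "abs_cproj z = abs_cproj w"
  shows "z $ i = 0 \<longleftrightarrow> w $ i = 0"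
  using abs_cproj_eq_iff[OF assms(1,2)] assms(3) by auto

lemma abs_cproj_in_line_m_iff:
  assumes "z \<noteq> 0"
  shows "abs_cproj z \<in> line_m k l \<longleftrightarrow> z $ k = 0 \<and> z $ l = 0"
proof
  assume "abs_cproj z \<in> line_m k l"
  then obtain w where "w \<noteq> 0" "abs_cproj z = abs_cproj w" "w $ k = 0" "w $ l = 0"
    unfolding line_m_def by auto
  then show "z $ k = 0 \<and> z $ l = 0" using abs_cproj_coord_0_iff[OF assms] by simp
qed (use assms in \<open>auto simp: line_m_def\<close>)

lemma abs_cproj_in_quadric_Q_iff:
  assumes "z \<noteq> 0"
  shows "abs_cproj z \<in> quadric_Q \<longleftrightarrow> z $ 0 * z $ 3 = z $ 1 * z $ 2"
proof
  assume "z $ 0 * z $ 3 = z $ 1 * z $ 2"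
  then show "abs_cproj z \<in> quadric_Q"
    using assms unfolding quadric_Q_def hypersurface_def by auto
next
  assume "abs_cproj z \<in> quadric_Q"
  then obtain w where w: "w \<noteq> 0" "abs_cproj z = abs_cproj w" "w $ 0 * w $ 3 = w $ 1 * w $ 2"
    unfolding quadric_Q_def hypersurface_def by auto
  then obtain c where "z = c *s w" using abs_cproj_eq_iff[of w z] assms by auto
  then show "z $ 0 * z $ 3 = z $ 1 * z $ 2" using w(3) by simp
qed

lemma map_F_chart:
  assumes "z \<noteq> 0" "z $ 0 * z $ 3 = z $ 1 * z $ 2"
  shows "z $ 0 \<noteq> 0 \<or> z $ 2 \<noteq> 0 \<Longrightarrow> chart_t z \<noteq> 0 \<and> map_F (abs_cproj z) = abs_cproj (chart_t z)"
    and "z $ 1 \<noteq> 0 \<or> z $ 3 \<noteq> 0 \<Longrightarrow> chart_u z \<noteq> 0 \<and> map_F (abs_cproj z) = abs_cproj (chart_u z)"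
proof -
  obtain s v t u where *: "(s, v) \<noteq> (0, 0)" "(t, u) \<noteq> (0, 0)" "z = segre s v t u"
    using assms by (rule quadric_param)
  have L: "lift_F s v t u \<noteq> 0" using *(1,2) by (rule lift_F_nonzero)
  have F: "map_F (abs_cproj z) = abs_cproj (lift_F s v t u)" using map_F_segre[OF *(1,2)] *(3) by simp
  show "chart_t z \<noteq> 0 \<and> map_F (abs_cproj z) = abs_cproj (chart_t z)" if "z $ 0 \<noteq> 0 \<or> z $ 2 \<noteq> 0"
  proof -
    have "t \<noteq> 0" using that by (auto simp: *(3) segre_def)
    with L show ?thesis unfolding F by (simp add: *(3) chart_segre abs_cproj_smult)
  qed
  show "chart_u z \<noteq> 0 \<and> map_F (abs_cproj z) = abs_cproj (chart_u z)" if "z $ 1 \<noteq> 0 \<or> z $ 3 \<noteq> 0"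
  proof -
    have "u \<noteq> 0" using that by (auto simp: *(3) segre_def)
    with L show ?thesis unfolding F by (simp add: *(3) chart_segre abs_cproj_smult)
  qed
qed

lemma homogeneous_poly_chart:
  "homogeneous_poly 2 (\<lambda>z. chart_t z $ i)" "homogeneous_poly 2 (\<lambda>z. chart_u z $ i)"
  unfolding chart_t_def chart_u_def numeral_2_eq_2
  by (intro homogeneous_poly_vec4 homogeneous_poly_intros)+

lemma regular_on_map_F: "regular_on quadric_Q map_F"
  unfolding regular_on_def
proof
  fix p assume "p \<in> quadric_Q"
  obtain z where z: "z \<noteq> 0" "p = abs_cproj z" by (rule cproj_cases)
  define W where "W i = quadric_Q \<inter> {abs_cproj z | z. z \<noteq> 0 \<and> z $ i \<noteq> 0}" for i :: 4
  have opW: "openin (subtopology zariski quadric_Q) (W i)" for i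
    unfolding W_def using openin_zariski_nonvanishing[OF homogeneous_poly.coord[of i]]
    by (rule openin_subtopology_Int2)
  have inW: "abs_cproj w \<in> W i \<longleftrightarrow> w $ 0 * w $ 3 = w $ 1 * w $ 2 \<and> w $ i \<noteq> 0" if "w \<noteq> 0" for w i
    using abs_cproj_in_quadric_Q_iff[OF that] abs_cproj_in_nonvanishing_iff[OF homogeneous_poly.coord[of i] that]
    by (simp add: W_def)
  \<comment> \<open>A nonzero Z_0 or Z_2 forces t <> 0, a nonzero Z_1 or Z_3 forces u <> 0; the
    chart is chosen accordingly.\<close>
  define ch where "ch = (\<lambda>i::4. if i = 0 \<or> i = 2 then chart_t else chart_u)"
  have ch: "ch i w \<noteq> 0 \<and> map_F (abs_cproj w) = abs_cproj (ch i w)" if "w \<noteq> 0" "abs_cproj w \<in> W i" for w i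
  proof -
    have w: "w $ 0 * w $ 3 = w $ 1 * w $ 2" "w $ i \<noteq> 0" using that inW by auto
    show ?thesis
    proof (cases "i = 0 \<or> i = 2")
      case True
      then show ?thesis using map_F_chart(1)[OF that(1) w(1)] w(2) by (auto simp: ch_def)
    next
      case False
      then have "i = 1 \<or> i = 3" using exhaust_4[of i] by auto
      then show ?thesis using map_F_chart(2)[OF that(1) w(1)] w(2) by (auto simp: ch_def)
    qed
  qed
  obtain i where "z $ i \<noteq> 0" using z(1) by (auto simp: vec_eq_iff)
  then have "p \<in> W i" using z \<open>p \<in> quadric_Q\<close> by (auto simp: W_def)
  moreover have "\<forall>j. homogeneous_poly 2 (\<lambda>z. ch i z $ j)"
    using homogeneous_poly_chart by (simp add: ch_def)
  ultimately show "\<exists>W d P. openin (subtopology zariski quadric_Q) W \<and> p \<in> W \<and>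
        (\<forall>i. homogeneous_poly d (\<lambda>z. P z $ i)) \<and>
        (\<forall>z. z \<noteq> 0 \<and> abs_cproj z \<in> W \<longrightarrow> P z \<noteq> 0 \<and> map_F (abs_cproj z) = abs_cproj (P z))"
    using opW ch by (intro exI[of _ "W i"] exI[of _ 2] exI[of _ "ch i"]) auto
qed

text \<open>The Segre vector for s = 1, t = Z_0, u = Z_1, v = (Z_1 Z_2 - Z_0 Z_3)/(2i Z_0 Z_1),
  multiplied by 2i Z_0 Z_1 to clear the denominator.\<close>

definition chart_inv :: "complex^4 \<Rightarrow> complex^4" where
  "chart_inv z = vec4 (2 * \<i> * (z $ 0 * (z $ 0 * z $ 1))) (2 * \<i> * (z $ 0 * (z $ 1 * z $ 1)))
     (z $ 0 * (z $ 1 * z $ 2 - z $ 0 * z $ 3)) (z $ 1 * (z $ 1 * z $ 2 - z $ 0 * z $ 3))"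

definition map_G :: "4 cproj \<Rightarrow> 4 cproj" where
  "map_G p = abs_cproj (chart_inv (rep_cproj p))"

lemma chart_inv_nonzero: "z $ 0 * z $ 1 \<noteq> 0 \<Longrightarrow> chart_inv z \<noteq> 0"
  by (simp add: chart_inv_def)

lemma map_G_abs:
  assumes "z $ 0 * z $ 1 \<noteq> 0"
  shows "map_G (abs_cproj z) = abs_cproj (chart_inv z)"
proof -
  have "z \<noteq> 0" using assms by auto
  then obtain c where c: "c \<noteq> 0" "rep_cproj (abs_cproj z) = c *s z"
    by (rule rep_abs_cproj)
  have "chart_inv (c *s z) = c ^ 3 *s chart_inv z"
    by (simp add: chart_inv_def vec4_eq_iff power3_eq_cube algebra_simps)
  then show ?thesis
    using abs_cproj_smult[OF chart_inv_nonzero[OF assms], of "c ^ 3"] c by (simp add: map_G_def)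
qed

text \<open>In Z_1 Z_2 - Z_0 Z_3 the terms with v^2 cancel and 2i s^3 t u v remains, which is linear
  in v; the other coordinates carry the same factor.\<close>

lemma chart_inv_lift_F: "chart_inv (lift_F s v t u) = (2 * \<i> * s ^ 5 * t * u) *s segre s v t u"
  by (simp add: chart_inv_def lift_F_def segre_def vec4_eq_iff power2_eq_square eval_nat_numeral algebra_simps)

lemma map_G_lift_F:
  assumes "s \<noteq> 0" "t \<noteq> 0" "u \<noteq> 0"
  shows "map_G (abs_cproj (lift_F s v t u)) = abs_cproj (segre s v t u)"
proof -
  have "map_G (abs_cproj (lift_F s v t u)) = abs_cproj (chart_inv (lift_F s v t u))"
    using assms by (intro map_G_abs) (simp add: lift_F_def)
  also have "\<dots> = abs_cproj (segre s v t u)"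
    unfolding chart_inv_lift_F using assms by (intro abs_cproj_smult segre_nonzero) auto
  finally show ?thesis .
qed

text \<open>Only Z_0 and Z_1 are kept away from zero; Z_2 and Z_3 may vanish. In the parameters v
  stays free.\<close>

definition torus :: "4 cproj set" where
  "torus = {abs_cproj z | z. z \<noteq> 0 \<and> z $ 0 * z $ 1 \<noteq> 0}"

lemma torus_poly: "homogeneous_poly 2 (\<lambda>z::complex^4. z $ 0 * z $ 1)"
  unfolding numeral_2_eq_2 by (intro homogeneous_poly_intros)

lemma openin_torus: "openin zariski torus"
  unfolding torus_def by (rule openin_zariski_nonvanishing[OF torus_poly])

lemma abs_cproj_in_torus_iff: "z \<noteq> 0 \<Longrightarrow> abs_cproj z \<in> torus \<longleftrightarrow> z $ 0 * z $ 1 \<noteq> 0"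
  unfolding torus_def by (rule abs_cproj_in_nonvanishing_iff[OF torus_poly])

lemma segre_lift_F_in_torus_iff:
  assumes "(s, v) \<noteq> (0, 0)" "(t, u) \<noteq> (0, 0)"
  shows "abs_cproj (segre s v t u) \<in> torus \<longleftrightarrow> s \<noteq> 0 \<and> t \<noteq> 0 \<and> u \<noteq> 0"
    and "abs_cproj (lift_F s v t u) \<in> torus \<longleftrightarrow> s \<noteq> 0 \<and> t \<noteq> 0 \<and> u \<noteq> 0"
  using abs_cproj_in_torus_iff[OF segre_nonzero[OF assms]] abs_cproj_in_torus_iff[OF lift_F_nonzero[OF assms]]
  by (auto simp: segre_def lift_F_def)

section \<open>Density of the common domain and birationality\<close>

text \<open>A common shift by \<open>e\<close> makes s, t and u nonzero except for at most three
  values of \<open>e\<close>, so it pushes any point of Q or K into \<open>torus\<close> while v is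
  kept fixed.\<close>

lemma eventually_shift_nonzero:
  fixes s t u :: complex
  shows "\<forall>\<^sub>F e in at 0. s + e \<noteq> 0 \<and> t + e \<noteq> 0 \<and> u + e \<noteq> 0"
proof -
  have "\<forall>\<^sub>F e in at 0. e \<noteq> - s \<and> e \<noteq> - t \<and> e \<noteq> - u"
    by (intro eventually_conj eventually_neq_at_within)
  then show ?thesis by eventually_elim (auto simp: add_eq_0_iff)
qed

lemma dense_torus_quadric: "zariski_open_dense_in quadric_Q (quadric_Q \<inter> torus)"
proof (rule zariski_open_dense_inI[OF openin_torus refl])
  fix p assume "p \<in> quadric_Q"
  then obtain s v t u where *: "(s, v) \<noteq> (0, 0)" "(t, u) \<noteq> (0, 0)" "p = abs_cproj (segre s v t u)"
    by (rule quadric_Q_cases)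
  define h where "h e = segre (s + e) v (t + e) (u + e)" for e
  have "continuous_on UNIV h"
    unfolding h_def segre_def by (intro continuous_on_vec4 continuous_intros)
  moreover have "\<forall>\<^sub>F e in at 0. h e \<noteq> 0 \<longrightarrow> abs_cproj (h e) \<in> quadric_Q \<inter> torus"
    using eventually_shift_nonzero[of s t u]
    by eventually_elim (auto simp: h_def segre_in_quadric_Q segre_lift_F_in_torus_iff)
  ultimately show "\<exists>h :: complex \<Rightarrow> complex^4. continuous_on UNIV h \<and> h 0 \<noteq> 0 \<and> p = abs_cproj (h 0) \<and>
      (\<forall>\<^sub>F e in at 0. h e \<noteq> 0 \<longrightarrow> abs_cproj (h e) \<in> quadric_Q \<inter> torus)"
    using segre_nonzero[OF *(1,2)] *(3) by (intro exI[of _ h]) (simp add: h_def)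
qed

lemma dense_torus_surface: "zariski_open_dense_in surface_K (surface_K \<inter> torus)"
proof (rule zariski_open_dense_inI[OF openin_torus refl])
  fix p assume "p \<in> surface_K"
  then obtain s v t u where *: "(s, v) \<noteq> (0, 0)" "(t, u) \<noteq> (0, 0)" "p = abs_cproj (lift_F s v t u)"
    by (rule surface_K_cases)
  define h where "h e = lift_F (s + e) v (t + e) (u + e)" for e
  have "continuous_on UNIV h"
    unfolding h_def lift_F_def by (intro continuous_on_vec4 continuous_intros)
  moreover have "\<forall>\<^sub>F e in at 0. h e \<noteq> 0 \<longrightarrow> abs_cproj (h e) \<in> surface_K \<inter> torus"
    using eventually_shift_nonzero[of s t u]
    by eventually_elim (auto simp: h_def lift_F_in_surface_K segre_lift_F_in_torus_iff)
  ultimately show "\<exists>h :: complex \<Rightarrow> complex^4. continuous_on UNIV h \<and> h 0 \<noteq> 0 \<and> p = abs_cproj (h 0) \<and>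
      (\<forall>\<^sub>F e in at 0. h e \<noteq> 0 \<longrightarrow> abs_cproj (h e) \<in> surface_K \<inter> torus)"
    using lift_F_nonzero[OF *(1,2)] *(3) by (intro exI[of _ h]) (simp add: h_def)
qed

lemma regular_on_map_G: "regular_on (surface_K \<inter> torus) map_G"
  unfolding regular_on_def
proof
  fix p assume "p \<in> surface_K \<inter> torus"
  have "homogeneous_poly 3 (\<lambda>z. chart_inv z $ i)" for i
    unfolding chart_inv_def numeral_3_eq_3 by (intro homogeneous_poly_vec4 homogeneous_poly_intros)
  moreover have "chart_inv z \<noteq> 0 \<and> map_G (abs_cproj z) = abs_cproj (chart_inv z)"
    if "z \<noteq> 0" "abs_cproj z \<in> surface_K \<inter> torus" for z
  proof -
    have "z $ 0 * z $ 1 \<noteq> 0" using that abs_cproj_in_torus_iff by blast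
    then show ?thesis using chart_inv_nonzero map_G_abs by blast
  qed
  moreover have "openin (subtopology zariski (surface_K \<inter> torus)) (surface_K \<inter> torus)"
    using openin_topspace[of "subtopology zariski (surface_K \<inter> torus)"] by (simp add: topspace_zariski)
  ultimately show "\<exists>W d P. openin (subtopology zariski (surface_K \<inter> torus)) W \<and> p \<in> W \<and>
        (\<forall>i. homogeneous_poly d (\<lambda>z. P z $ i)) \<and>
        (\<forall>z. z \<noteq> 0 \<and> abs_cproj z \<in> W \<longrightarrow> P z \<noteq> 0 \<and> map_G (abs_cproj z) = abs_cproj (P z))"
    using \<open>p \<in> surface_K \<inter> torus\<close>
    by (intro exI[of _ "surface_K \<inter> torus"] exI[of _ 3] exI[of _ chart_inv]) simp
qed

lemma map_F_torus:
  assumes "p \<in> quadric_Q \<inter> torus"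
  shows "map_F p \<in> surface_K \<inter> torus" "map_G (map_F p) = p"
proof -
  obtain s v t u where *: "(s, v) \<noteq> (0, 0)" "(t, u) \<noteq> (0, 0)" "p = abs_cproj (segre s v t u)"
    by (rule quadric_Q_cases[OF IntD1[OF assms]])
  then have nz: "s \<noteq> 0" "t \<noteq> 0" "u \<noteq> 0"
    using assms segre_lift_F_in_torus_iff(1)[OF *(1,2)] by auto
  have F: "map_F p = abs_cproj (lift_F s v t u)" using map_F_segre[OF *(1,2)] *(3) by simp
  show "map_F p \<in> surface_K \<inter> torus"
    using lift_F_in_surface_K[OF lift_F_nonzero[OF *(1,2)]] segre_lift_F_in_torus_iff(2)[OF *(1,2)] nz F by simp
  show "map_G (map_F p) = p" using map_G_lift_F[OF nz] F *(3) by simp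
qed

lemma map_G_torus:
  assumes "q \<in> surface_K \<inter> torus"
  shows "map_G q \<in> quadric_Q" "map_F (map_G q) = q"
proof -
  obtain s v t u where *: "(s, v) \<noteq> (0, 0)" "(t, u) \<noteq> (0, 0)" "q = abs_cproj (lift_F s v t u)"
    by (rule surface_K_cases[OF IntD1[OF assms]])
  then have nz: "s \<noteq> 0" "t \<noteq> 0" "u \<noteq> 0"
    using assms segre_lift_F_in_torus_iff(2)[OF *(1,2)] by auto
  have G: "map_G q = abs_cproj (segre s v t u)" using map_G_lift_F[OF nz] *(3) by simp
  show "map_G q \<in> quadric_Q" using segre_in_quadric_Q[OF segre_nonzero[OF *(1,2)]] G by simp
  show "map_F (map_G q) = q" using map_F_segre[OF *(1,2)] G *(3) by simp
qed

lemma birational_map_F: "birational_equivalence quadric_Q surface_K quadric_Q map_F"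
  unfolding birational_equivalence_def
proof (intro conjI exI)
  show "rational_map quadric_Q surface_K quadric_Q map_F"
    unfolding rational_map_def using zariski_open_dense_in_self regular_on_map_F map_F_image by simp
  show "rational_map surface_K quadric_Q (surface_K \<inter> torus) map_G"
    unfolding rational_map_def using dense_torus_surface regular_on_map_G map_G_torus(1) by auto
  show "rational_left_inverse quadric_Q quadric_Q map_F (surface_K \<inter> torus) map_G"
    unfolding rational_left_inverse_def
    using dense_torus_quadric map_F_torus by (intro exI[of _ "quadric_Q \<inter> torus"]) auto
  show "rational_left_inverse surface_K (surface_K \<inter> torus) map_G quadric_Q map_F"
    unfolding rational_left_inverse_def
    using dense_torus_surface map_G_torus by (intro exI[of _ "surface_K \<inter> torus"]) auto
qed

text \<open>Removing m_02 and m_13 from Q means t, u <> 0. Then the first coordinate s^2 t of the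
  image tells whether s = 0. If s <> 0, \<open>map_G\<close> recovers the point.\<close>

lemma inj_on_map_F: "inj_on map_F (quadric_Q - (line_m 0 2 \<union> line_m 1 3))"
proof (rule inj_onI)
  fix p p'
  assume p: "p \<in> quadric_Q - (line_m 0 2 \<union> line_m 1 3)" and p': "p' \<in> quadric_Q - (line_m 0 2 \<union> line_m 1 3)"
    and eq: "map_F p = map_F p'"
  have off_lines: "\<exists>s v t u. (s, v) \<noteq> (0, 0) \<and> t \<noteq> 0 \<and> u \<noteq> 0 \<and> p = abs_cproj (segre s v t u) \<and>
      map_F p = abs_cproj (lift_F s v t u)"
    if off: "p \<in> quadric_Q - (line_m 0 2 \<union> line_m 1 3)" for p
  proof -
    obtain s v t u where *: "(s, v) \<noteq> (0, 0)" "(t, u) \<noteq> (0, 0)" "p = abs_cproj (segre s v t u)"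
      by (rule quadric_Q_cases[OF DiffD1[OF off]])
    have "t \<noteq> 0" "u \<noteq> 0"
      using off abs_cproj_in_line_m_iff[OF segre_nonzero[OF *(1,2)]] *(3) by (auto simp: segre_def)
    then show ?thesis using * map_F_segre[OF *(1,2)] by blast
  qed
  obtain s v t u where 1: "(s, v) \<noteq> (0, 0)" "t \<noteq> 0" "u \<noteq> 0" "p = abs_cproj (segre s v t u)"
      "map_F p = abs_cproj (lift_F s v t u)" using off_lines[OF p] by blast
  obtain s' v' t' u' where 2: "(s', v') \<noteq> (0, 0)" "t' \<noteq> 0" "u' \<noteq> 0" "p' = abs_cproj (segre s' v' t' u')"
      "map_F p' = abs_cproj (lift_F s' v' t' u')" using off_lines[OF p'] by blast
  have nz: "lift_F s v t u \<noteq> 0" "lift_F s' v' t' u' \<noteq> 0" using lift_F_nonzero[OF 1(1)] lift_F_nonzero[OF 2(1)] 1(2) 2(2) by simp_all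
  show "p = p'"
  proof (cases "s = 0")
    case False
    have "s' \<noteq> 0"
      using abs_cproj_coord_0_iff[OF nz, of 0] eq 1 2 False by (auto simp: lift_F_def)
    then show ?thesis
      using map_G_lift_F[of s t u v] map_G_lift_F[of s' t' u' v'] False 1 2 eq by simp
  next
    case True
    have s': "s' = 0"
      using abs_cproj_coord_0_iff[OF nz, of 0] eq 1 2 True by (auto simp: lift_F_def)
    have v: "v \<noteq> 0" "v' \<noteq> 0" using True s' 1 2 by auto
    \<comment> \<open>For s = 0 the map F is the identity on m_01.\<close>
    have "lift_F s v t u = v *s segre s v t u" "lift_F s' v' t' u' = v' *s segre s' v' t' u'"
      using True s' by (simp_all add: lift_F_def segre_def vec4_eq_iff power2_eq_square)
    then show ?thesis
      using abs_cproj_smult[OF segre_nonzero, of s v t u v] abs_cproj_smult[OF segre_nonzero, of s' v' t' u' v']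
        1 2 v eq by simp
  qed
qed

section \<open>The restrictions to the two lines\<close>

text \<open>The second chart is the first one with the roles of \<open>A\<close> and
  \<open>B\<close> exchanged; applying \<open>\<alpha>\<close> and \<open>\<beta>\<close> to a
  relation between representatives gives the gluing w' = 1/w.\<close>

lemma projective_line_sphere_charts:
  fixes A B :: "complex^'n::finite"
  assumes hom: "homogeneous_poly 1 \<alpha>" "homogeneous_poly 1 \<beta>"
    and \<alpha>: "\<And>a b. \<alpha> (a *s A + b *s B) = a" and \<beta>: "\<And>a b. \<beta> (a *s A + b *s B) = b"
    and S: "S = {abs_cproj (a *s A + b *s B) | a b. (a, b) \<noteq> (0, 0)}"
  shows "sphere_charts S (\<lambda>w. abs_cproj (A + w *s B)) (\<lambda>w. abs_cproj (w *s A + B))"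
proof
  have S': "S = {abs_cproj (a *s B + b *s A) | a b. (a, b) \<noteq> (0, 0)}"
    unfolding S by (rule Collect_cong) (metis add.commute prod.inject)
  note chart0 = projective_line_chart[OF hom \<alpha> \<beta> S]
  have dual: "\<beta> (a *s B + b *s A) = a" "\<alpha> (a *s B + b *s A) = b" for a b
    by (subst add.commute, rule \<beta> \<alpha>)+
  have chart1: "\<exists>g. homeomorphism UNIV (range (\<lambda>w. abs_cproj (w *s A + B))) (\<lambda>w. abs_cproj (w *s A + B)) g"
    "openin (top_of_set S) (range (\<lambda>w. abs_cproj (w *s A + B)))"
    using projective_line_chart[OF hom(2,1) dual S'] by (simp_all add: add.commute)
  show "\<exists>g. homeomorphism UNIV (range (\<lambda>w. abs_cproj (A + w *s B))) (\<lambda>w. abs_cproj (A + w *s B)) g"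
    "openin (top_of_set S) (range (\<lambda>w. abs_cproj (A + w *s B)))"
    "\<exists>g. homeomorphism UNIV (range (\<lambda>w. abs_cproj (w *s A + B))) (\<lambda>w. abs_cproj (w *s A + B)) g"
    "openin (top_of_set S) (range (\<lambda>w. abs_cproj (w *s A + B)))"
    by (fact chart0 chart1)+
  have \<alpha>': "\<alpha> (A + w *s B) = 1" "\<alpha> (w *s A + B) = w" "\<alpha> 0 = 0" for w
    using \<alpha>[of 1 w] \<alpha>[of w 1] \<alpha>[of 0 0] by simp_all
  have \<beta>': "\<beta> (A + w *s B) = w" "\<beta> (w *s A + B) = 1" "\<beta> 0 = 0" for w
    using \<beta>[of 1 w] \<beta>[of w 1] \<beta>[of 0 0] by simp_all
  have nz: "A + w *s B \<noteq> 0" "w *s A + B \<noteq> 0" for w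
    using \<alpha>' \<beta>' by (metis zero_neq_one)+
  show glue: "abs_cproj (A + w *s B) = abs_cproj (w' *s A + B) \<longleftrightarrow> w * w' = 1" for w w'
  proof
    assume "abs_cproj (A + w *s B) = abs_cproj (w' *s A + B)"
    then obtain c where c: "w' *s A + B = c *s (A + w *s B)"
      using abs_cproj_eq_iff[OF nz] by blast
    have "w' = c" "1 = c * w"
      using arg_cong[OF c, of \<alpha>] arg_cong[OF c, of \<beta>] \<alpha>' \<beta>'
        homogeneous_poly_smult[OF hom(1), of c "A + w *s B"] homogeneous_poly_smult[OF hom(2), of c "A + w *s B"]
      by simp_all
    then show "w * w' = 1" by (simp add: mult.commute)
  next
    assume 1: "w * w' = 1"
    then have "w' \<noteq> 0" by auto
    moreover have "w' *s A + B = w' *s (A + w *s B)"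
      using 1 by (simp add: vec_eq_iff algebra_simps)
    ultimately show "abs_cproj (A + w *s B) = abs_cproj (w' *s A + B)"
      using abs_cproj_smult[OF nz(1)[of w], of w'] by simp
  qed
  have in_S: "abs_cproj (a *s A + b *s B) \<in> S" if "(a, b) \<noteq> (0, 0)" for a b
    using that S by blast
  show "S = range (\<lambda>w. abs_cproj (A + w *s B)) \<union> range (\<lambda>w. abs_cproj (w *s A + B))"
  proof
    show "range (\<lambda>w. abs_cproj (A + w *s B)) \<union> range (\<lambda>w. abs_cproj (w *s A + B)) \<subseteq> S"
      using in_S[of 1] in_S[of _ 1] by auto
    show "S \<subseteq> range (\<lambda>w. abs_cproj (A + w *s B)) \<union> range (\<lambda>w. abs_cproj (w *s A + B))"
    proof
      fix p assume "p \<in> S"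
      then obtain a b where ab: "p = abs_cproj (a *s A + b *s B)" "(a, b) \<noteq> (0, 0)" by (auto simp: S)
      show "p \<in> range (\<lambda>w. abs_cproj (A + w *s B)) \<union> range (\<lambda>w. abs_cproj (w *s A + B))"
      proof (cases "a = 0")
        case True
        then have "b \<noteq> 0" "a *s A + b *s B = b *s (0 *s A + B)" using ab(2) by simp_all
        then have "p = abs_cproj (0 *s A + B)" using abs_cproj_smult[OF nz(2)] ab(1) by metis
        then show ?thesis by blast
      next
        case False
        then have "a *s A + b *s B = a *s (A + (b / a) *s B)" by (simp add: vec_eq_iff algebra_simps)
        then have "p = abs_cproj (A + (b / a) *s B)" using abs_cproj_smult[OF nz(1) False] ab(1) by metis
        then show ?thesis by blast
      qed
    qed
  qed
qed

lemma line_m_span: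
  assumes "\<And>z. z $ k = 0 \<Longrightarrow> z $ l = 0 \<Longrightarrow> z = \<alpha> z *s A + \<beta> z *s B"
    and "\<And>a b. \<alpha> (a *s A + b *s B) = a" "\<And>a b. \<beta> (a *s A + b *s B) = b"
    and "A $ k = 0" "A $ l = 0" "B $ k = 0" "B $ l = 0"
  shows "line_m k l = {abs_cproj (a *s A + b *s B) | a b. (a, b) \<noteq> (0, 0)}"
proof (intro set_eqI iffI)
  fix p assume "p \<in> line_m k l"
  then obtain z where z: "p = abs_cproj z" "z \<noteq> 0" "z = \<alpha> z *s A + \<beta> z *s B"
    unfolding line_m_def using assms(1) by blast
  then have "(\<alpha> z, \<beta> z) \<noteq> (0, 0)" by (metis add.right_neutral prod.inject vector_smult_lzero)
  with z(1,3) show "p \<in> {abs_cproj (a *s A + b *s B) | a b. (a, b) \<noteq> (0, 0)}"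
    unfolding mem_Collect_eq by (intro exI[of _ "\<alpha> z"] exI[of _ "\<beta> z"]) simp
next
  fix p assume "p \<in> {abs_cproj (a *s A + b *s B) | a b. (a, b) \<noteq> (0, 0)}"
  then obtain a b where ab: "p = abs_cproj (a *s A + b *s B)" "(a, b) \<noteq> (0, 0)" by blast
  have "a *s A + b *s B \<noteq> 0"
    using ab(2) assms(2)[of a b] assms(3)[of a b] assms(2)[of 0 0] assms(3)[of 0 0] by auto
  then show "p \<in> line_m k l" using assms(4-7) ab(1) by (auto simp: line_m_def)
qed

text \<open>The parameter \<open>c\<close> shifts the affine coordinate on the line. With \<open>c = \<plusminus>\<i>/2\<close> in the source
  and \<open>c = 1/4\<close> in the target, completing the square turns \<open>F\<close> into \<open>w \<mapsto> w\<^sup>2\<close>.\<close>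

lemma line_m_02_charts:
  "sphere_charts (line_m 0 2) (\<lambda>w. abs_cproj (vec4 0 1 0 (w + c))) (\<lambda>w. abs_cproj (vec4 0 w 0 (1 + c * w)))"
proof -
  define A B where "A = vec4 0 1 0 c" and "B = vec4 0 0 0 1"
  \<comment> \<open>The second form has to vanish on \<open>A\<close>, hence the correction by
    \<open>c\<close>.\<close>
  define \<alpha> \<beta> where "\<alpha> z = z $ 1" and "\<beta> z = z $ 3 - c * z $ 1" for z :: "complex^4"
  have hom: "homogeneous_poly 1 \<alpha>" "homogeneous_poly 1 \<beta>"
    unfolding \<alpha>_def \<beta>_def One_nat_def by (intro homogeneous_poly_intros)+
  have dual: "\<alpha> (a *s A + b *s B) = a" "\<beta> (a *s A + b *s B) = b" for a b
    by (simp_all add: \<alpha>_def \<beta>_def A_def B_def)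
  have "line_m 0 2 = {abs_cproj (a *s A + b *s B) | a b. (a, b) \<noteq> (0, 0)}"
    by (rule line_m_span[OF _ dual]) (simp_all add: \<alpha>_def \<beta>_def A_def B_def vec4_eq_iff)
  from projective_line_sphere_charts[OF hom dual this]
  show ?thesis by (simp add: A_def B_def smult_vec4 plus_vec4 algebra_simps)
qed

lemma line_m_13_charts:
  "sphere_charts (line_m 1 3) (\<lambda>w. abs_cproj (vec4 1 0 (w + c) 0)) (\<lambda>w. abs_cproj (vec4 w 0 (1 + c * w) 0))"
proof -
  define A B where "A = vec4 1 0 c 0" and "B = vec4 0 0 1 0"
  define \<alpha> \<beta> where "\<alpha> z = z $ 0" and "\<beta> z = z $ 2 - c * z $ 0" for z :: "complex^4"
  have hom: "homogeneous_poly 1 \<alpha>" "homogeneous_poly 1 \<beta>"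
    unfolding \<alpha>_def \<beta>_def One_nat_def by (intro homogeneous_poly_intros)+
  have dual: "\<alpha> (a *s A + b *s B) = a" "\<beta> (a *s A + b *s B) = b" for a b
    by (simp_all add: \<alpha>_def \<beta>_def A_def B_def)
  have "line_m 1 3 = {abs_cproj (a *s A + b *s B) | a b. (a, b) \<noteq> (0, 0)}"
    by (rule line_m_span[OF _ dual]) (simp_all add: \<alpha>_def \<beta>_def A_def B_def vec4_eq_iff)
  from projective_line_sphere_charts[OF hom dual this]
  show ?thesis by (simp add: A_def B_def smult_vec4 plus_vec4 algebra_simps)
qed

text \<open>On t = 0 with s = u = 1, F is v |-> v^2 - iv, which becomes w^2 + 1/4 for v = w + i/2.
  The second chart is the same substitution with [s,v] = [w, 1 + (i/2) w].\<close>

lemma branched_covering_02: "branched_covering 2 map_F (line_m 0 2) (line_m 0 2)"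
proof (rule branched_covering_square[OF line_m_02_charts[of "\<i> / 2"] line_m_02_charts[of "1 / 4"]])
  fix w
  show "map_F (abs_cproj (vec4 0 1 0 (w + \<i> / 2))) = abs_cproj (vec4 0 1 0 (w\<^sup>2 + 1 / 4))"
  proof -
    have "(w + \<i> / 2)\<^sup>2 - \<i> * (w + \<i> / 2) = w\<^sup>2 + 1 / 4"
      by (simp add: power2_eq_square field_simps)
    then show ?thesis using map_F_segre[of 1 "w + \<i> / 2" 0 1] by (simp add: segre_def lift_F_def)
  qed
  show "map_F (abs_cproj (vec4 0 w 0 (1 + \<i> / 2 * w))) = abs_cproj (vec4 0 (w\<^sup>2) 0 (1 + 1 / 4 * w\<^sup>2))"
  proof -
    have "(w, 1 + \<i> / 2 * w) \<noteq> (0, 0)" by auto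
    moreover have "(1 + \<i> / 2 * w)\<^sup>2 - \<i> * w * (1 + \<i> / 2 * w) = 1 + 1 / 4 * w\<^sup>2"
      by (simp add: power2_eq_square field_simps)
    ultimately show ?thesis using map_F_segre[of w "1 + \<i> / 2 * w" 0 1] by (simp add: segre_def lift_F_def)
  qed
qed

text \<open>Here u = 0, so v^2 + iv takes over: the shift in the source changes sign, the finite
  branch value 1/4 does not.\<close>

lemma branched_covering_13: "branched_covering 2 map_F (line_m 1 3) (line_m 1 3)"
proof (rule branched_covering_square[OF line_m_13_charts[of "- \<i> / 2"] line_m_13_charts[of "1 / 4"]])
  fix w
  show "map_F (abs_cproj (vec4 1 0 (w + - \<i> / 2) 0)) = abs_cproj (vec4 1 0 (w\<^sup>2 + 1 / 4) 0)"
  proof -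
    have "(w - \<i> / 2)\<^sup>2 + \<i> * (w - \<i> / 2) = w\<^sup>2 + 1 / 4"
      by (simp add: power2_eq_square field_simps)
    then show ?thesis using map_F_segre[of 1 "w - \<i> / 2" 1 0] by (simp add: segre_def lift_F_def)
  qed
  show "map_F (abs_cproj (vec4 w 0 (1 + - \<i> / 2 * w) 0)) = abs_cproj (vec4 (w\<^sup>2) 0 (1 + 1 / 4 * w\<^sup>2) 0)"
  proof -
    have "(w, 1 + - \<i> / 2 * w) \<noteq> (0, 0)" by auto
    moreover have "(1 + - \<i> / 2 * w)\<^sup>2 + \<i> * w * (1 + - \<i> / 2 * w) = 1 + 1 / 4 * w\<^sup>2"
      by (simp add: power2_eq_square field_simps)
    ultimately show ?thesis using map_F_segre[of w "1 + - \<i> / 2 * w" 1 0] by (simp add: segre_def lift_F_def)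
  qed
qed

section \<open>Singular points and cusps\<close>

lemma partial_eqI:
  assumes "\<And>w. ((\<lambda>w. f (\<chi> i. if i = k then w else z $ i)) has_field_derivative D) (at (z $ k))"
  shows "partial k f z = D"
  unfolding partial_def using assms by (rule DERIV_imp_deriv)

lemma partial_poly_K:
  "partial 0 poly_K = (\<lambda>z. 2 * z$0 * (z$3)\<^sup>2 - 2 * z$1 * z$2 * z$3 + 2 * (z$1)\<^sup>2 * z$2 + 4 * z$0 * z$1 * z$3)"
  "partial 1 poly_K = (\<lambda>z. 2 * z$1 * (z$2)\<^sup>2 - 2 * z$0 * z$2 * z$3 + 4 * z$0 * z$1 * z$2 + 2 * (z$0)\<^sup>2 * z$3)"
  "partial 2 poly_K = (\<lambda>z. 2 * (z$1)\<^sup>2 * z$2 - 2 * z$0 * z$1 * z$3 + 2 * z$0 * (z$1)\<^sup>2)"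
  "partial 3 poly_K = (\<lambda>z. 2 * (z$0)\<^sup>2 * z$3 - 2 * z$0 * z$1 * z$2 + 2 * (z$0)\<^sup>2 * z$1)"
  by (rule ext, rule partial_eqI, simp add: poly_K_def,
      (auto intro!: derivative_eq_intros simp: power2_eq_square algebra_simps)[1])+

lemma hessian_poly_K:
  "hessian poly_K z $ 0 $ 0 = 2 * (z$3)\<^sup>2 + 4 * z$1 * z$3"
  "hessian poly_K z $ 0 $ 1 = - 2 * z$2 * z$3 + 4 * z$1 * z$2 + 4 * z$0 * z$3"
  "hessian poly_K z $ 0 $ 2 = - 2 * z$1 * z$3 + 2 * (z$1)\<^sup>2"
  "hessian poly_K z $ 0 $ 3 = - 2 * z$1 * z$2 + 4 * z$0 * z$3 + 4 * z$0 * z$1"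
  "hessian poly_K z $ 1 $ 0 = - 2 * z$2 * z$3 + 4 * z$1 * z$2 + 4 * z$0 * z$3"
  "hessian poly_K z $ 1 $ 1 = 2 * (z$2)\<^sup>2 + 4 * z$0 * z$2"
  "hessian poly_K z $ 1 $ 2 = 4 * z$1 * z$2 - 2 * z$0 * z$3 + 4 * z$0 * z$1"
  "hessian poly_K z $ 1 $ 3 = - 2 * z$0 * z$2 + 2 * (z$0)\<^sup>2"
  "hessian poly_K z $ 2 $ 0 = - 2 * z$1 * z$3 + 2 * (z$1)\<^sup>2"
  "hessian poly_K z $ 2 $ 1 = 4 * z$1 * z$2 - 2 * z$0 * z$3 + 4 * z$0 * z$1"
  "hessian poly_K z $ 2 $ 2 = 2 * (z$1)\<^sup>2"
  "hessian poly_K z $ 2 $ 3 = - 2 * z$0 * z$1"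
  "hessian poly_K z $ 3 $ 0 = - 2 * z$1 * z$2 + 4 * z$0 * z$3 + 4 * z$0 * z$1"
  "hessian poly_K z $ 3 $ 1 = - 2 * z$0 * z$2 + 2 * (z$0)\<^sup>2"
  "hessian poly_K z $ 3 $ 2 = - 2 * z$0 * z$1"
  "hessian poly_K z $ 3 $ 3 = 2 * (z$0)\<^sup>2"
  unfolding hessian_def vec_lambda_beta partial_poly_K
  by (rule partial_eqI, simp,
      (auto intro!: derivative_eq_intros simp: power2_eq_square algebra_simps)[1])+

text \<open>With D = Z_1 Z_2 - Z_0 Z_3 the last two partial derivatives are 2 Z_1 (D + Z_0 Z_1) and
  2 Z_0 (Z_0 Z_1 - D). If Z_0 Z_1 <> 0, both cannot vanish. On Z_0 = 0 and on Z_1 = 0 the polynomial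
  K is a square of a monomial, which leaves the lines.\<close>

lemma singular_poly_K_iff:
  "poly_K z = 0 \<and> (\<forall>k. partial k poly_K z = 0) \<longleftrightarrow>
     z $ 0 = 0 \<and> z $ 2 = 0 \<or> z $ 1 = 0 \<and> z $ 3 = 0 \<or> z $ 0 = 0 \<and> z $ 1 = 0"
  (is "?sing \<longleftrightarrow> ?lines")
proof
  assume ?sing
  then have K: "poly_K z = 0" and "partial 2 poly_K z = 0" "partial 3 poly_K z = 0" by blast+
  then have p: "z$1 * ((z$1 * z$2 - z$0 * z$3) + z$0 * z$1) = 0" "z$0 * (z$0 * z$1 - (z$1 * z$2 - z$0 * z$3)) = 0"
    unfolding partial_poly_K by algebra+
  have "z $ 0 = 0 \<or> z $ 1 = 0"
  proof (rule ccontr)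
    assume n: "\<not> (z $ 0 = 0 \<or> z $ 1 = 0)"
    with p have "(z$1 * z$2 - z$0 * z$3) + z$0 * z$1 = 0" "z$0 * z$1 - (z$1 * z$2 - z$0 * z$3) = 0" by simp_all
    then have "2 * (z $ 0 * z $ 1) = 0" by algebra
    with n show False by simp
  qed
  then show ?lines using K by (auto simp: poly_K_def)
next
  assume ?lines
  then show ?sing unfolding forall_index_4 partial_poly_K by (auto simp: poly_K_def)
qed

lemma singular_locus_poly_K: "singular_locus poly_K = line_m 0 2 \<union> line_m 1 3 \<union> line_m 0 1"
  unfolding singular_locus_def singular_poly_K_iff line_m_def by blast

text \<open>The factor 2 allows \<open>v\<close> to have entries linear in the coordinates, without
  a square root of 2; the quadratic form of \<open>H\<close> is twice the square of a linear
  form.\<close>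

lemma minors_zero_if_rank_one:
  fixes H :: "complex^4^4"
  assumes "\<And>i j. H $ i $ j = 2 * v $ i * v $ j"
  shows "\<forall>i j k l. H $ i $ k * H $ j $ l - H $ i $ l * H $ j $ k = 0"
  by (simp add: assms algebra_simps)

text \<open>On each of the three lines the Hessian has nonzero entries only in two rows and the same
  two columns: 0, 2 on m_02, then 1, 3 on m_13, and 0, 1 on m_01. A single principal minor therefore
  decides on m_02 and m_13, and on m_01 the rank is at most one throughout.\<close>

lemma minors_hessian_poly_K_iff:
  assumes "z $ 0 = 0 \<and> z $ 2 = 0 \<or> z $ 1 = 0 \<and> z $ 3 = 0 \<or> z $ 0 = 0 \<and> z $ 1 = 0"
  shows "(\<forall>i j k l. hessian poly_K z $ i $ k * hessian poly_K z $ j $ l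
                  - hessian poly_K z $ i $ l * hessian poly_K z $ j $ k = 0) \<longleftrightarrow>
     z $ 0 = 0 \<and> z $ 1 = 0 \<or> z $ 0 = 0 \<and> z $ 2 = 0 \<and> z $ 1 = 4 * z $ 3 \<or>
     z $ 1 = 0 \<and> z $ 3 = 0 \<and> z $ 0 = 4 * z $ 2" (is "?minors \<longleftrightarrow> ?cusp")
proof
  assume m: ?minors
  from assms show ?cusp
  proof (elim disjE)
    assume 0: "z $ 0 = 0 \<and> z $ 2 = 0"
    have "hessian poly_K z $ 0 $ 0 * hessian poly_K z $ 2 $ 2 - hessian poly_K z $ 0 $ 2 * hessian poly_K z $ 2 $ 0 = 0"
      using m by blast
    \<comment> \<open>The principal minor on the indices 0, 2 in factored form; z_1 = 0 leads to
      m_01, the other factor to [0,1,0,1/4].\<close>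
    then have "4 * ((z $ 1) ^ 3 * (4 * z $ 3 - z $ 1)) = 0"
      using 0 unfolding hessian_poly_K by algebra
    then show ?cusp using 0 by auto
  next
    assume 0: "z $ 1 = 0 \<and> z $ 3 = 0"
    have "hessian poly_K z $ 1 $ 1 * hessian poly_K z $ 3 $ 3 - hessian poly_K z $ 1 $ 3 * hessian poly_K z $ 3 $ 1 = 0"
      using m by blast
    then have "4 * ((z $ 0) ^ 3 * (4 * z $ 2 - z $ 0)) = 0"
      using 0 unfolding hessian_poly_K by algebra
    then show ?cusp using 0 by auto
  qed auto
next
  assume ?cusp
  then have "\<exists>v. \<forall>i j. hessian poly_K z $ i $ j = 2 * v $ i * v $ j"
  proof (elim disjE conjE)
    assume "z $ 0 = 0" "z $ 1 = 0"
    then show ?thesis unfolding forall_index_4 hessian_poly_K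
      \<comment> \<open>Here and below, up to sign the entries of the witness are square roots of
        half the diagonal entries; the off-diagonal entry fixes their relative sign.\<close>
      by (intro exI[of _ "vec4 (- z $ 3) (z $ 2) 0 0"]) (simp add: power2_eq_square)
  next
    assume "z $ 0 = 0" "z $ 2 = 0" "z $ 1 = 4 * z $ 3"
    then show ?thesis unfolding forall_index_4 hessian_poly_K
      by (intro exI[of _ "vec4 (3 * z $ 3) 0 (4 * z $ 3) 0"]) (simp add: power2_eq_square)
  next
    assume "z $ 1 = 0" "z $ 3 = 0" "z $ 0 = 4 * z $ 2"
    then show ?thesis unfolding forall_index_4 hessian_poly_K
      by (intro exI[of _ "vec4 0 (3 * z $ 2) 0 (4 * z $ 2)"]) (simp add: power2_eq_square)
  qed
  then show ?minors using minors_zero_if_rank_one by blast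
qed

lemma cusp_points_poly_K:
  "cusp_points poly_K = line_m 0 1 \<union> {pt 0 1 0 (1/4), pt 1 0 (1/4) 0}"
proof -
  define cusp where "cusp z \<longleftrightarrow> z $ 0 = 0 \<and> z $ 1 = 0 \<or> z $ 0 = 0 \<and> z $ 2 = 0 \<and> z $ 1 = 4 * z $ 3 \<or>
     z $ 1 = 0 \<and> z $ 3 = 0 \<and> z $ 0 = 4 * z $ 2" for z :: "complex^4"
  have sing: "abs_cproj z \<in> singular_locus poly_K \<longleftrightarrow>
      z $ 0 = 0 \<and> z $ 2 = 0 \<or> z $ 1 = 0 \<and> z $ 3 = 0 \<or> z $ 0 = 0 \<and> z $ 1 = 0" if "z \<noteq> 0" for z
    unfolding singular_locus_poly_K Un_iff abs_cproj_in_line_m_iff[OF that] by blast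
  have "cusp_points poly_K = {abs_cproj z | z. z \<noteq> 0 \<and> cusp z}"
  proof -
    have "abs_cproj z \<in> singular_locus poly_K \<and>
       (\<forall>i j k l. hessian poly_K z $ i $ k * hessian poly_K z $ j $ l
                - hessian poly_K z $ i $ l * hessian poly_K z $ j $ k = 0) \<longleftrightarrow> cusp z" if "z \<noteq> 0" for z
      unfolding sing[OF that] using minors_hessian_poly_K_iff[of z] cusp_def[of z] by blast
    then show ?thesis unfolding cusp_points_def by blast
  qed
  also have "\<dots> = line_m 0 1 \<union> {pt 0 1 0 (1/4), pt 1 0 (1/4) 0}"
  proof (intro set_eqI iffI)
    fix p assume "p \<in> {abs_cproj z | z. z \<noteq> 0 \<and> cusp z}"
    then obtain z where z: "p = abs_cproj z" "z \<noteq> 0" "cusp z" by blast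
    from z(3) show "p \<in> line_m 0 1 \<union> {pt 0 1 0 (1/4), pt 1 0 (1/4) 0}"
      unfolding cusp_def
    proof (elim disjE conjE)
      assume "z $ 0 = 0" "z $ 1 = 0"
      then show ?thesis using z(1,2) abs_cproj_in_line_m_iff by simp
    next
      assume 0: "z $ 0 = 0" "z $ 2 = 0" "z $ 1 = 4 * z $ 3"
      then have "z = z $ 1 *s vec4 0 1 0 (1/4)" by (simp add: vec4_eq_iff)
      moreover have "z $ 1 \<noteq> 0" using z(2) 0 by (auto simp: vec4_eq_iff)
      ultimately have "p = pt 0 1 0 (1/4)"
        using abs_cproj_smult[of "vec4 0 1 0 (1/4)" "z $ 1"] by (simp add: pt_vec4 z(1))
      then show ?thesis by simp
    next
      assume 0: "z $ 1 = 0" "z $ 3 = 0" "z $ 0 = 4 * z $ 2"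
      then have "z = z $ 0 *s vec4 1 0 (1/4) 0" by (simp add: vec4_eq_iff)
      moreover have "z $ 0 \<noteq> 0" using z(2) 0 by (auto simp: vec4_eq_iff)
      ultimately have "p = pt 1 0 (1/4) 0"
        using abs_cproj_smult[of "vec4 1 0 (1/4) 0" "z $ 0"] by (simp add: pt_vec4 z(1))
      then show ?thesis by simp
    qed
  next
    fix p assume "p \<in> line_m 0 1 \<union> {pt 0 1 0 (1/4), pt 1 0 (1/4) 0}"
    then consider z where "p = abs_cproj z" "z \<noteq> 0" "z $ 0 = 0" "z $ 1 = 0"
      | "p = abs_cproj (vec4 0 1 0 (1/4))" | "p = abs_cproj (vec4 1 0 (1/4) 0)"
      by (auto simp: line_m_def pt_vec4)
    then show "p \<in> {abs_cproj z | z. z \<noteq> 0 \<and> cusp z}"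
    proof cases
      case (1 z)
      then show ?thesis by (auto simp: cusp_def)
    next
      case 2
      moreover have "cusp (vec4 0 1 0 (1/4))" by (simp add: cusp_def)
      ultimately show ?thesis unfolding mem_Collect_eq
        by (intro exI[of _ "vec4 0 1 0 (1/4)"]) simp
    next
      case 3
      moreover have "cusp (vec4 1 0 (1/4) 0)" by (simp add: cusp_def)
      ultimately show ?thesis unfolding mem_Collect_eq
        by (intro exI[of _ "vec4 1 0 (1/4) 0"]) simp
    qed
  qed
  finally show ?thesis .
qed

theorem theorem7p1:
  shows "(\<forall>s v t u. (s, v) \<noteq> (0, 0) \<longrightarrow> (t, u) \<noteq> (0, 0) \<longrightarrow>
            map_F (pt (s * t) (s * u) (t * v) (u * v)) =
              pt (s\<^sup>2 * t) (s\<^sup>2 * u) (t * (v\<^sup>2 + \<i> * s * v)) (u * (v\<^sup>2 - \<i> * s * v))) \<and>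
         birational_equivalence quadric_Q surface_K quadric_Q map_F \<and>
         map_F ` quadric_Q = surface_K \<and>
         inj_on map_F (quadric_Q - (line_m 0 2 \<union> line_m 1 3)) \<and>
         branched_covering 2 map_F (line_m 0 2) (line_m 0 2) \<and>
         branched_covering 2 map_F (line_m 1 3) (line_m 1 3) \<and>
         singular_locus poly_K = line_m 0 2 \<union> line_m 1 3 \<union> line_m 0 1 \<and>
         cusp_points poly_K = line_m 0 1 \<union> {pt 0 1 0 (1/4), pt 1 0 (1/4) 0}"
proof (intro conjI allI impI)
  fix s v t u :: complex
  assume "(s, v) \<noteq> (0, 0)" "(t, u) \<noteq> (0, 0)"
  then show "map_F (pt (s * t) (s * u) (t * v) (u * v)) =
      pt (s\<^sup>2 * t) (s\<^sup>2 * u) (t * (v\<^sup>2 + \<i> * s * v)) (u * (v\<^sup>2 - \<i> * s * v))"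
    using map_F_segre by (simp add: pt_vec4 segre_def lift_F_def)
qed (fact birational_map_F map_F_image inj_on_map_F branched_covering_02 branched_covering_13
    singular_locus_poly_K cusp_points_poly_K)+

end
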